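(* The following statements hold. (a) For every $(\mu,u)\in\mathcal P(\mathcal X)\times\mathcal U$, $\mathcal L_u\mu\in\mathcal P(\mathcal X)$. (b) For every $(\mu,u)\in\mathcal P(\mathcal X)\times\mathcal U$ and every $j$ with $O_j\neq\varnothing$, $\widetilde{\mathcal L}_{u,j}\mu$ is a finite nonnegative measure supported on $O_j$ (i.e. giving zero mass to $\mathcal X\setminus O_j$). (c) The functions $(\mu,u)\mapsto p_j(\mu,u)$ are Borel measurable and satisfy $\sum_{j}p_j(\mu,u)=1$, the sum running over the indices $j\in\{1,\dots,r+1\}$ of nonempty classes. (d) The globally extended maps $(\mu,u)\mapsto\Phi_j(\mu,u)$ are Borel measurable and satisfy $\Phi_j(\mu,u)(O_j)=1$. (e) The values assigned through $\rho_j$ on $\{p_j=0\}$ do not affect the law of any reachable information-state trajectory; that is, for two choices of the families $(\rho_j)_j$, the trajectories $(Y_t,\pi_t)_{t\ge0}$ generated from the same $\pi_0$, controls and observations by $\pi_{t+1}=\Phi_{Y_{t+1}}(\pi_t,U_t)$ have the same law.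
   Context: Model. $(\Omega,\mathcal F,\mathbb P)$ is a complete probability space; $\mathcal X$ (states), $\mathcal U$ (actions), $\mathsf E$, $\mathsf V$ (noises) are standard Borel spaces; $\mathcal P(\mathcal X)$ is the set of probability measures on $(\mathcal X,\mathcal B(\mathcal X))$ with its canonical Borel $\sigma$-field, generated by the evaluations $\mu\mapsto\mu(C)$, $C\in\mathcal B(\mathcal X)$. $G:\mathcal X\times\mathcal U\times\mathsf E\times\mathsf V\to\mathcal X$ is Borel measurable and $X_{t+1}=G(X_t,U_t,\eta_{t+1},\varepsilon_{t+1})$ for $t\ge 0$, where $(\eta_t)_{t\ge1}$ is i.i.d. with law $\nu_\eta$ on $\mathsf E$, $(\varepsilon_t)_{t\ge1}$ is i.i.d. with law $\nu_\varepsilon$ on $\mathsf V$, and $X_0$, $(\eta_t)_t$, $(\varepsilon_t)_t$ are mutually independent. The controlled kernel is $Q(C\mid x,u)=\int_{\mathsf E}\int_{\mathsf V}\mathbf 1_C(G(x,u,e,v))\,\nu_\varepsilon(dv)\,\nu_\eta(de)$. Observations. $A_1,\dots,A_m$ is a finite measurable partition of $\mathcal X$; $O_j=\bigcup_{i\in J_j}A_i$ for $j=1,\dots,r$, with $J_1,\dots,J_r\subseteq\{1,\dots,m\}$ nonempty and pairwise disjoint; $O_{r+1}=\mathcal X\setminus\bigcup_{j\le r}O_j$ (index $r+1$ is omitted if this is empty). The observation is $Y_t=j\iff X_t\in O_j$. The information is $\mathcal H_t=\sigma(Y_0,U_0,Y_1,U_1,\dots,U_{t-1},Y_t)$, $\mathcal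 H_0=\sigma(Y_0)$, and $U_t$ is $\mathcal H_t$-measurable for all $t$. $\pi_t(C)=\mathbb P(X_t\in C\mid\mathcal H_t)$ denotes a regular version with values in $\mathcal P(\mathcal X)$. Filter operators. For $\mu\in\mathcal P(\mathcal X)$, $u\in\mathcal U$ and $j$ with $O_j\ne\varnothing$: $(\mathcal L_u\mu)(C)=\int_{\mathcal X}Q(C\mid x,u)\,\mu(dx)$; $\widetilde{\mathcal L}_{u,j}\mu(C)=(\mathcal L_u\mu)(C\cap O_j)$; $p_j(\mu,u)=(\mathcal L_u\mu)(O_j)$. For each nonempty $O_j$ fix $\rho_j\in\mathcal P(\mathcal X)$ with $\rho_j(O_j)=1$, and set $\Phi_j(\mu,u)=\widetilde{\mathcal L}_{u,j}\mu/p_j(\mu,u)$ if $p_j(\mu,u)>0$ and $\Phi_j(\mu,u)=\rho_j$ if $p_j(\mu,u)=0$. *)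

theory Defs
  imports "HOL-Probability.Probability"
begin

text \<open>A measurable space is represented by a measure of which only the carrier and the
  measurable sets are used; \<^term>\<open>prob_algebra S\<close> is the space of probability measures on
  \<^term>\<open>S\<close> with the \<open>\<sigma>\<close>-algebra generated by the evaluations.\<close>

definition standard_borel :: "'a measure \<Rightarrow> bool" where
  "standard_borel N \<longleftrightarrow>
     (\<exists>T. completely_metrizable_space T \<and> separable_space T \<and> topspace T = space N \<and>
          sets N = sigma_sets (space N) {S. openin T S})"

definition obs_class ::
  "'x measure \<Rightarrow> (nat \<Rightarrow> 'x set) \<Rightarrow> nat \<Rightarrow> (nat \<Rightarrow> nat set) \<Rightarrow> nat \<Rightarrow> 'x set" where
  "obs_class S A r J j =
     (if j \<in> {1..r} then (\<Union>i\<in>J j. A i)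
      else if j = r + 1 then space S - (\<Union>k\<in>{1..r}. \<Union>i\<in>J k. A i)
      else {})"

definition obs_indices ::
  "'x measure \<Rightarrow> (nat \<Rightarrow> 'x set) \<Rightarrow> nat \<Rightarrow> (nat \<Rightarrow> nat set) \<Rightarrow> nat set" where
  "obs_indices S A r J = {j \<in> {1..r + 1}. obs_class S A r J j \<noteq> {}}"

locale observed_model =
  fixes S :: "'x measure" and Act :: "'u measure" and E :: "'e measure" and V :: "'v measure"
    and G :: "'x \<times> 'u \<times> 'e \<times> 'v \<Rightarrow> 'x"
    and \<nu>E :: "'e measure" and \<nu>V :: "'v measure"
    and m :: nat and A :: "nat \<Rightarrow> 'x set" and r :: nat and J :: "nat \<Rightarrow> nat set"
  assumes standard_borel_S: "standard_borel S"
    and standard_borel_Act: "standard_borel Act"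
    and standard_borel_E: "standard_borel E"
    and standard_borel_V: "standard_borel V"
    and measurable_G: "G \<in> S \<Otimes>\<^sub>M Act \<Otimes>\<^sub>M E \<Otimes>\<^sub>M V \<rightarrow>\<^sub>M S"
    and \<nu>E: "\<nu>E \<in> space (prob_algebra E)"
    and \<nu>V: "\<nu>V \<in> space (prob_algebra V)"
    and sets_A: "\<And>i. i \<in> {1..m} \<Longrightarrow> A i \<in> sets S"
    and disjoint_A: "disjoint_family_on A {1..m}"
    and cover_A: "(\<Union>i\<in>{1..m}. A i) = space S"
    and J_subset: "\<And>j. j \<in> {1..r} \<Longrightarrow> J j \<subseteq> {1..m}"
    and J_nonempty: "\<And>j. j \<in> {1..r} \<Longrightarrow> J j \<noteq> {}"
    and disjoint_J: "disjoint_family_on J {1..r}"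

definition ctrl_kernel ::
  "('x \<times> 'u \<times> 'e \<times> 'v \<Rightarrow> 'x) \<Rightarrow> 'e measure \<Rightarrow> 'v measure \<Rightarrow> 'x set \<Rightarrow> 'x \<Rightarrow> 'u \<Rightarrow> ennreal" where
  "ctrl_kernel G \<nu>E \<nu>V C x u = (\<integral>\<^sup>+e. \<integral>\<^sup>+v. indicator C (G (x, u, e, v)) \<partial>\<nu>V \<partial>\<nu>E)"

text \<open>\<^const>\<open>measure_of\<close> returns the null measure when the given set function is not
  a measure, so whether it takes the prescribed values is a matter of proof.\<close>

definition predict_op ::
  "'x measure \<Rightarrow> ('x \<times> 'u \<times> 'e \<times> 'v \<Rightarrow> 'x) \<Rightarrow> 'e measure \<Rightarrow> 'v measure
   \<Rightarrow> 'u \<Rightarrow> 'x measure \<Rightarrow> 'x measure" where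
  "predict_op S G \<nu>E \<nu>V u \<mu> =
     measure_of (space S) (sets S) (\<lambda>C. \<integral>\<^sup>+x. ctrl_kernel G \<nu>E \<nu>V C x u \<partial>\<mu>)"

definition restricted_op ::
  "'x measure \<Rightarrow> ('x \<times> 'u \<times> 'e \<times> 'v \<Rightarrow> 'x) \<Rightarrow> 'e measure \<Rightarrow> 'v measure
   \<Rightarrow> (nat \<Rightarrow> 'x set) \<Rightarrow> 'u \<Rightarrow> nat \<Rightarrow> 'x measure \<Rightarrow> 'x measure" where
  "restricted_op S G \<nu>E \<nu>V Ob u j \<mu> =
     measure_of (space S) (sets S) (\<lambda>C. emeasure (predict_op S G \<nu>E \<nu>V u \<mu>) (C \<inter> Ob j))"

definition obs_prob ::
  "'x measure \<Rightarrow> ('x \<times> 'u \<times> 'e \<times> 'v \<Rightarrow> 'x) \<Rightarrow> 'e measure \<Rightarrow> 'v measure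
   \<Rightarrow> (nat \<Rightarrow> 'x set) \<Rightarrow> nat \<Rightarrow> 'x measure \<Rightarrow> 'u \<Rightarrow> real" where
  "obs_prob S G \<nu>E \<nu>V Ob j \<mu> u = measure (predict_op S G \<nu>E \<nu>V u \<mu>) (Ob j)"

definition filter_map ::
  "'x measure \<Rightarrow> ('x \<times> 'u \<times> 'e \<times> 'v \<Rightarrow> 'x) \<Rightarrow> 'e measure \<Rightarrow> 'v measure
   \<Rightarrow> (nat \<Rightarrow> 'x set) \<Rightarrow> (nat \<Rightarrow> 'x measure) \<Rightarrow> nat \<Rightarrow> 'x measure \<Rightarrow> 'u \<Rightarrow> 'x measure" where
  "filter_map S G \<nu>E \<nu>V Ob \<rho> j \<mu> u =
     (if obs_prob S G \<nu>E \<nu>V Ob j \<mu> u > 0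
      then scale_measure (ennreal (1 / obs_prob S G \<nu>E \<nu>V Ob j \<mu> u))
             (restricted_op S G \<nu>E \<nu>V Ob u j \<mu>)
      else \<rho> j)"

definition admissible_family ::
  "'x measure \<Rightarrow> nat set \<Rightarrow> (nat \<Rightarrow> 'x set) \<Rightarrow> (nat \<Rightarrow> 'x measure) \<Rightarrow> bool" where
  "admissible_family S I Ob \<rho> \<longleftrightarrow>
     (\<forall>j\<in>I. \<rho> j \<in> space (prob_algebra S) \<and> emeasure (\<rho> j) (Ob j) = 1)"

text \<open>The \<open>\<sigma>\<close>-algebra generated by \<open>Y 0, U 0, Y 1, \<dots>, U (t - 1), Y t\<close>; the
  observations are discrete.\<close>

definition info_algebra ::
  "'w measure \<Rightarrow> 'u measure \<Rightarrow> (nat \<Rightarrow> 'w \<Rightarrow> nat) \<Rightarrow> (nat \<Rightarrow> 'w \<Rightarrow> 'u) \<Rightarrow> nat \<Rightarrow> 'w measure" where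
  "info_algebra M Act Y U t =
     sigma (space M)
       ({Y s -` B \<inter> space M |s B. s \<le> t \<and> B \<in> sets (count_space UNIV)} \<union>
        {U s -` B \<inter> space M |s B. s < t \<and> B \<in> sets Act})"

definition regular_cond_law ::
  "'w measure \<Rightarrow> 'w measure \<Rightarrow> 'x measure \<Rightarrow> ('w \<Rightarrow> 'x) \<Rightarrow> ('w \<Rightarrow> 'x measure) \<Rightarrow> bool" where
  "regular_cond_law M F S Z \<kappa> \<longleftrightarrow>
     \<kappa> \<in> F \<rightarrow>\<^sub>M prob_algebra S \<and>
     (\<forall>C\<in>sets S. AE \<omega> in M.
        measure (\<kappa> \<omega>) C = real_cond_exp M F (indicator (Z -` C \<inter> space M)) \<omega>)"

text \<open>The value of the noises at time \<open>0\<close> is irrelevant: both sequences start at time \<open>1\<close>.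
  Independence of the initial state and the two noise sequences is that of the three
  \<open>\<sigma>\<close>-algebras they generate, each sequence being one random element of a product space.\<close>

locale controlled_process =
  observed_model S Act E V G \<nu>E \<nu>V m A r J + prob_space M + complete_measure M
  for S :: "'x measure" and Act :: "'u measure" and E :: "'e measure" and V :: "'v measure"
    and G :: "'x \<times> 'u \<times> 'e \<times> 'v \<Rightarrow> 'x"
    and \<nu>E :: "'e measure" and \<nu>V :: "'v measure"
    and m :: nat and A :: "nat \<Rightarrow> 'x set" and r :: nat and J :: "nat \<Rightarrow> nat set"
    and M :: "'w measure" +
  fixes X :: "nat \<Rightarrow> 'w \<Rightarrow> 'x" and U :: "nat \<Rightarrow> 'w \<Rightarrow> 'u"
    and \<eta> :: "nat \<Rightarrow> 'w \<Rightarrow> 'e" and \<epsilon> :: "nat \<Rightarrow> 'w \<Rightarrow> 'v" and Y :: "nat \<Rightarrow> 'w \<Rightarrow> nat"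
  assumes X_0: "X 0 \<in> M \<rightarrow>\<^sub>M S"
    and iid_\<eta>: "indep_vars (\<lambda>_. E) \<eta> {1..}" "\<And>t. t \<ge> 1 \<Longrightarrow> distr M E (\<eta> t) = \<nu>E"
    and iid_\<epsilon>: "indep_vars (\<lambda>_. V) \<epsilon> {1..}" "\<And>t. t \<ge> 1 \<Longrightarrow> distr M V (\<epsilon> t) = \<nu>V"
    and indep: "indep_sets (\<lambda>i. sets
          ([vimage_algebra (space M) (X 0) S,
            vimage_algebra (space M) (\<lambda>\<omega>. \<lambda>t\<in>{1..}. \<eta> t \<omega>) (\<Pi>\<^sub>M t\<in>{1..}. E),
            vimage_algebra (space M) (\<lambda>\<omega>. \<lambda>t\<in>{1..}. \<epsilon> t \<omega>) (\<Pi>\<^sub>M t\<in>{1..}. V)] ! i)) {..<3}"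
    and X_Suc: "\<And>t \<omega>. \<omega> \<in> space M \<Longrightarrow>
          X (Suc t) \<omega> = G (X t \<omega>, U t \<omega>, \<eta> (Suc t) \<omega>, \<epsilon> (Suc t) \<omega>)"
    and Y_eq: "\<And>t \<omega> j. \<omega> \<in> space M \<Longrightarrow> j \<in> {1..r + 1} \<Longrightarrow>
          Y t \<omega> = j \<longleftrightarrow> X t \<omega> \<in> obs_class S A r J j"
    and U_adapted: "\<And>t. U t \<in> info_algebra M Act Y U t \<rightarrow>\<^sub>M Act"

primrec info_state ::
  "(nat \<Rightarrow> 'x measure \<Rightarrow> 'u \<Rightarrow> 'x measure) \<Rightarrow> ('w \<Rightarrow> 'x measure) \<Rightarrow> (nat \<Rightarrow> 'w \<Rightarrow> 'u)
   \<Rightarrow> (nat \<Rightarrow> 'w \<Rightarrow> nat) \<Rightarrow> nat \<Rightarrow> 'w \<Rightarrow> 'x measure" where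
  "info_state \<Phi> \<pi>\<^sub>0 U Y 0 \<omega> = \<pi>\<^sub>0 \<omega>"
| "info_state \<Phi> \<pi>\<^sub>0 U Y (Suc t) \<omega> = \<Phi> (Y (Suc t) \<omega>) (info_state \<Phi> \<pi>\<^sub>0 U Y t \<omega>) (U t \<omega>)"

definition info_trajectory ::
  "(nat \<Rightarrow> 'x measure \<Rightarrow> 'u \<Rightarrow> 'x measure) \<Rightarrow> ('w \<Rightarrow> 'x measure) \<Rightarrow> (nat \<Rightarrow> 'w \<Rightarrow> 'u)
   \<Rightarrow> (nat \<Rightarrow> 'w \<Rightarrow> nat) \<Rightarrow> 'w \<Rightarrow> nat \<Rightarrow> nat \<times> 'x measure" where
  "info_trajectory \<Phi> \<pi>\<^sub>0 U Y \<omega> t = (Y t \<omega>, info_state \<Phi> \<pi>\<^sub>0 U Y t \<omega>)"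

definition trajectory_space :: "'x measure \<Rightarrow> nat set \<Rightarrow> (nat \<Rightarrow> nat \<times> 'x measure) measure" where
  "trajectory_space S I = (\<Pi>\<^sub>M t\<in>UNIV. count_space I \<Otimes>\<^sub>M prob_algebra S)"

end

theory Submission
  imports Defs
begin

text \<open>Write \<open>\<nu>\<close> for the product of the two noise laws.  The one-step prediction from \<open>\<mu>\<close> under the
  action \<open>u\<close> is the image of \<open>\<mu> \<Otimes> \<nu>\<close> under \<open>(x, e, v) \<mapsto> G (x, u, e, v)\<close>.  This makes it a probability
  measure and, because products and images of laws depend measurably on the laws, a measurable
  function of \<open>(\<mu>, u)\<close>.  Restriction, class probability and normalised update are then obtained from
  it by evaluating at measurable sets, which is how the \<open>\<sigma>\<close>-algebra on probability measures is
  generated; the probabilities \<open>p\<^sub>j\<close> add up to one since the nonempty classes partition the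
  state space.

  The statement about the laws of trajectories says that almost surely the fallback measures \<open>\<rho>\<^sub>j\<close>
  are never used: along almost every path, \<open>p\<^sub>j(\<pi>\<^sub>t, U\<^sub>t) > 0\<close> for the class \<open>j = Y\<^sub>t\<^sub>+\<^sub>1\<close> that is in fact
  observed (\<open>AE_observed_prob_pos\<close>).  Two choices of \<open>\<rho>\<close> then produce the same path up to a null
  set, hence the same law.  To see that the observed class has positive predicted probability one
  needs the meaning of the recursion: \<open>\<pi>\<^sub>t\<close> is the conditional law of \<open>X\<^sub>t\<close> given the information at
  time \<open>t\<close> (\<open>info_state_cond_law\<close>).  Then the conditional probability of \<open>Y\<^sub>t\<^sub>+\<^sub>1 = j\<close> is
  \<open>p\<^sub>j(\<pi>\<^sub>t, U\<^sub>t)\<close>, and an event whose conditional probability vanishes on a set that belongs to the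
  information is null on that set.

  The conditional law is propagated in two moves.  Prediction (\<open>predicted_cond_law\<close>) uses that the
  noises of the next step are independent of everything that determines \<open>X\<^sub>t\<close>, \<open>U\<^sub>t\<close> and the
  information (\<open>next_noise_cond_law\<close>), followed by the induction hypothesis for \<open>X\<^sub>t\<close>; both are
  instances of integrating a function of two arguments against a conditional law
  (\<open>cond_law_nn_integral\<close>).  Update (\<open>updated_cond_law\<close>) is Bayes' rule for the finitely many values
  of \<open>Y\<^sub>t\<^sub>+\<^sub>1\<close>, the only new information since \<open>U\<^sub>t\<close> is already determined by the old one.\<close>

section \<open>Set functions that are measures\<close>

text \<open>Identifies a measure that is given only by a prescribed set function; exhibiting a measure
  with the prescribed values spares the verification of countable additivity.\<close>

lemma measure_of_eqI_emeasure:
  assumes "sets N = sets S" and "\<And>C. C \<in> sets S \<Longrightarrow> f C = emeasure N C"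
  shows "measure_of (space S) (sets S) f = N"
proof -
  have sp: "space N = space S" using assms(1) by (rule sets_eq_imp_space_eq)
  have "measure_of (space S) (sets S) f = measure_of (space S) (sets S) (emeasure N)"
    by (rule measure_of_eq[OF sets.space_closed]) (simp add: assms(2) sets.sigma_sets_eq)
  also have "\<dots> = measure_of (space N) (sets N) (emeasure N)"
    by (simp add: assms(1) sp)
  finally show ?thesis by (simp add: measure_of_of_measure)
qed

section \<open>Observation classes\<close>

context observed_model
begin

abbreviation Ob :: "nat \<Rightarrow> 'x set" where "Ob \<equiv> obs_class S A r J"
abbreviation classes :: "nat set" where "classes \<equiv> obs_indices S A r J"

lemma finite_classes: "finite classes"
  by (simp add: obs_indices_def)

lemma sets_Ob_union: "j \<in> {1..r} \<Longrightarrow> (\<Union>i\<in>J j. A i) \<in> sets S"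
  using J_subset[of j] sets_A by (intro sets.finite_UN) (auto intro: finite_subset)

lemma sets_Ob [measurable]: "Ob j \<in> sets S"
  unfolding obs_class_def
  using sets_Ob_union by (auto intro!: sets.finite_UN sets.Diff simp del: UN_simps)

lemma Ob_cover: "(\<Union>j\<in>classes. Ob j) = space S"
proof
  show "(\<Union>j\<in>classes. Ob j) \<subseteq> space S"
    using sets.sets_into_space[OF sets_Ob] by blast
  show "space S \<subseteq> (\<Union>j\<in>classes. Ob j)"
  proof
    fix x assume x: "x \<in> space S"
    show "x \<in> (\<Union>j\<in>classes. Ob j)"
    proof (cases "\<exists>j\<in>{1..r}. x \<in> (\<Union>i\<in>J j. A i)")
      case True
      then obtain j where "j \<in> {1..r}" "x \<in> (\<Union>i\<in>J j. A i)" by blast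
      then have "j \<in> {1..r}" "x \<in> Ob j" by (simp_all add: obs_class_def)
      then have "j \<in> classes" "x \<in> Ob j" by (auto simp: obs_indices_def)
      then show ?thesis by blast
    next
      case False
      then have "x \<in> Ob (r + 1)" using x by (auto simp: obs_class_def)
      then have "r + 1 \<in> classes" "x \<in> Ob (r + 1)" by (auto simp: obs_indices_def)
      then show ?thesis by blast
    qed
  qed
qed

lemma Ob_disjoint: "disjoint_family_on Ob classes"
proof -
  have low: "Ob j \<inter> Ob k = {}" if "j \<in> {1..r}" "k \<in> {1..r}" "j \<noteq> k" for j k
  proof -
    have "A i \<inter> A i' = {}" if "i \<in> J j" "i' \<in> J k" for i i'
    proof -
      have "i \<in> {1..m}" "i' \<in> {1..m}" using that J_subset \<open>j \<in> {1..r}\<close> \<open>k \<in> {1..r}\<close> by blast+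
      moreover have "i \<noteq> i'"
        using disjoint_J that \<open>j \<in> {1..r}\<close> \<open>k \<in> {1..r}\<close> \<open>j \<noteq> k\<close>
        unfolding disjoint_family_on_def by blast
      ultimately show ?thesis using disjoint_A unfolding disjoint_family_on_def by blast
    qed
    then show ?thesis using that by (auto simp: obs_class_def)
  qed
  have high: "Ob j \<inter> Ob (r + 1) = {}" if "j \<in> {1..r}" for j
    using that by (auto simp: obs_class_def)
  show ?thesis
    unfolding disjoint_family_on_def
  proof (intro ballI impI)
    fix j k assume jk: "j \<in> classes" "k \<in> classes" "j \<noteq> k"
    then have "j \<in> {1..r} \<or> j = r + 1" "k \<in> {1..r} \<or> k = r + 1"
      by (auto simp: obs_indices_def)
    then show "Ob j \<inter> Ob k = {}" using low[of j k] high[of j] high[of k] jk(3) by blast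
  qed
qed

section \<open>Prediction and update operators\<close>

abbreviation noise :: "('e \<times> 'v) measure" where "noise \<equiv> \<nu>E \<Otimes>\<^sub>M \<nu>V"
abbreviation predict :: "'u \<Rightarrow> 'x measure \<Rightarrow> 'x measure" where
  "predict \<equiv> predict_op S G \<nu>E \<nu>V"
abbreviation restricted :: "'u \<Rightarrow> nat \<Rightarrow> 'x measure \<Rightarrow> 'x measure" where
  "restricted \<equiv> restricted_op S G \<nu>E \<nu>V Ob"
abbreviation p :: "nat \<Rightarrow> 'x measure \<Rightarrow> 'u \<Rightarrow> real" where
  "p \<equiv> obs_prob S G \<nu>E \<nu>V Ob"
abbreviation \<Phi> :: "(nat \<Rightarrow> 'x measure) \<Rightarrow> nat \<Rightarrow> 'x measure \<Rightarrow> 'u \<Rightarrow> 'x measure" where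
  "\<Phi> \<equiv> filter_map S G \<nu>E \<nu>V Ob"

lemma sets_noise_laws [measurable_cong]: "sets \<nu>E = sets E" "sets \<nu>V = sets V"
  using \<nu>E \<nu>V by (auto simp: space_prob_algebra)

lemma prob_space_noise_laws: "prob_space \<nu>E" "prob_space \<nu>V" "prob_space noise"
  using \<nu>E \<nu>V by (auto simp: space_prob_algebra intro: prob_space_pair)

lemma noise_in_prob_algebra [measurable]: "noise \<in> space (prob_algebra (E \<Otimes>\<^sub>M V))"
  using prob_space_noise_laws sets_noise_laws
  by (auto simp: space_prob_algebra intro!: sets_pair_measure_cong)

lemma ctrl_kernel_eq_noise_integral:
  assumes x: "x \<in> space S" and u: "u \<in> space Act" and C [measurable]: "C \<in> sets S"
  shows "ctrl_kernel G \<nu>E \<nu>V C x u = (\<integral>\<^sup>+(e, v). indicator C (G (x, u, e, v)) \<partial>noise)"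
proof -
  interpret V: prob_space \<nu>V by (rule prob_space_noise_laws)
  note measurable_G [measurable] and x [measurable] and u [measurable]
  have "(\<lambda>(e, v). indicator C (G (x, u, e, v)) :: ennreal) \<in> borel_measurable (\<nu>E \<Otimes>\<^sub>M \<nu>V)"
    by measurable
  from V.nn_integral_fst[OF this] show ?thesis
    by (simp add: ctrl_kernel_def)
qed

text \<open>The one-step prediction is the law of the next state when the current one is drawn
  from \<open>\<mu>\<close> and the noises are drawn independently of it.  All measurability in the pair
  \<open>(\<mu>, u)\<close> comes from this form, since products and images of laws depend measurably on
  the laws.\<close>

lemma
  assumes \<mu>: "\<mu> \<in> space (prob_algebra S)" and u: "u \<in> space Act"
  defines "D \<equiv> distr (\<mu> \<Otimes>\<^sub>M noise) S (\<lambda>(x, e, v). G (x, u, e, v))"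
  shows predict_eq_distr: "predict u \<mu> = D"
    and kernel_integral_eq_distr: "\<And>C. C \<in> sets S \<Longrightarrow> (\<integral>\<^sup>+x. ctrl_kernel G \<nu>E \<nu>V C x u \<partial>\<mu>) = emeasure D C"
proof -
  interpret N: prob_space noise by (rule prob_space_noise_laws)
  note measurable_G [measurable] and u [measurable]
  have [measurable_cong]: "sets \<mu> = sets S" using \<mu> by (simp add: space_prob_algebra)
  have sp: "space \<mu> = space S" by (rule sets_eq_imp_space_eq) fact
  show *: "(\<integral>\<^sup>+x. ctrl_kernel G \<nu>E \<nu>V C x u \<partial>\<mu>) = emeasure D C"
    if C [measurable]: "C \<in> sets S" for C
  proof -
    have "emeasure D C = (\<integral>\<^sup>+z. indicator C z \<partial>D)"
      by (simp add: D_def)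
    also have "\<dots> = (\<integral>\<^sup>+(x, e, v). indicator C (G (x, u, e, v)) \<partial>(\<mu> \<Otimes>\<^sub>M noise))"
      unfolding D_def by (subst nn_integral_distr) (auto simp: case_prod_unfold)
    also have "\<dots> = (\<integral>\<^sup>+x. \<integral>\<^sup>+(e, v). indicator C (G (x, u, e, v)) \<partial>noise \<partial>\<mu>)"
      by (subst N.nn_integral_fst[symmetric]) (auto simp: case_prod_unfold)
    also have "\<dots> = (\<integral>\<^sup>+x. ctrl_kernel G \<nu>E \<nu>V C x u \<partial>\<mu>)"
      using u by (intro nn_integral_cong) (simp add: ctrl_kernel_eq_noise_integral sp)
    finally show ?thesis by simp
  qed
  show "predict u \<mu> = D"
    unfolding predict_op_def
    by (rule measure_of_eqI_emeasure) (simp_all add: * D_def)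
qed

lemma emeasure_predict:
  assumes "\<mu> \<in> space (prob_algebra S)" "u \<in> space Act" "C \<in> sets S"
  shows "emeasure (predict u \<mu>) C = (\<integral>\<^sup>+x. ctrl_kernel G \<nu>E \<nu>V C x u \<partial>\<mu>)"
  using predict_eq_distr[OF assms(1,2)] kernel_integral_eq_distr[OF assms(1,2)] assms(3) by simp

lemma measurable_predict [measurable]:
  "(\<lambda>(\<mu>, u). predict u \<mu>) \<in> prob_algebra S \<Otimes>\<^sub>M Act \<rightarrow>\<^sub>M prob_algebra S"
proof -
  note measurable_G [measurable]
  have "(\<lambda>z. distr (fst z \<Otimes>\<^sub>M noise) S (\<lambda>(x, e, v). G (x, snd z, e, v)))
      \<in> prob_algebra S \<Otimes>\<^sub>M Act \<rightarrow>\<^sub>M prob_algebra S"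
    by measurable
  then show ?thesis
    by (rule measurable_cong[THEN iffD1, rotated])
       (auto simp: space_pair_measure predict_eq_distr)
qed

lemma predict_in_prob_algebra:
  assumes "\<mu> \<in> space (prob_algebra S)" "u \<in> space Act"
  shows "predict u \<mu> \<in> space (prob_algebra S)"
  using measurable_space[OF measurable_predict, of "(\<mu>, u)"] assms
  by (simp add: space_pair_measure)

lemma predict_prob_space:
  assumes "\<mu> \<in> space (prob_algebra S)" "u \<in> space Act"
  shows "prob_space (predict u \<mu>)" "sets (predict u \<mu>) = sets S" "space (predict u \<mu>) = space S"
  using predict_in_prob_algebra[OF assms]
  by (auto simp: space_prob_algebra dest: sets_eq_imp_space_eq)

lemma restricted_eq_density:
  assumes "\<mu> \<in> space (prob_algebra S)" "u \<in> space Act"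
  shows "restricted u j \<mu> = density (predict u \<mu>) (indicator (Ob j))"
  unfolding restricted_op_def using predict_prob_space[OF assms]
  by (intro measure_of_eqI_emeasure)
     (auto simp: emeasure_restricted Int_commute)

lemma emeasure_restricted_op:
  assumes "\<mu> \<in> space (prob_algebra S)" "u \<in> space Act" "C \<in> sets S"
  shows "emeasure (restricted u j \<mu>) C = emeasure (predict u \<mu>) (C \<inter> Ob j)"
  using predict_prob_space[OF assms(1,2)] assms
  by (simp add: restricted_eq_density emeasure_restricted Int_commute)

lemma sets_restricted:
  assumes "\<mu> \<in> space (prob_algebra S)" "u \<in> space Act"
  shows "sets (restricted u j \<mu>) = sets S" "space (restricted u j \<mu>) = space S"
  using predict_prob_space[OF assms] by (auto simp: restricted_eq_density[OF assms])

lemma finite_measure_restricted: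
  assumes "\<mu> \<in> space (prob_algebra S)" "u \<in> space Act"
  shows "finite_measure (restricted u j \<mu>)"
proof -
  interpret P: prob_space "predict u \<mu>" by (rule predict_prob_space[OF assms])
  show ?thesis
    by (rule finite_measureI) (simp add: emeasure_restricted_op[OF assms] sets_restricted[OF assms])
qed

lemma p_measurable [measurable]:
  "(\<lambda>(\<mu>, u). p j \<mu> u) \<in> borel_measurable (prob_algebra S \<Otimes>\<^sub>M Act)"
  using measurable_compose[OF measurable_predict measurable_measure_prob_algebra[OF sets_Ob[of j]]]
  by (simp add: obs_prob_def case_prod_unfold)

lemma emeasure_predict_Ob:
  assumes "\<mu> \<in> space (prob_algebra S)" "u \<in> space Act"
  shows "emeasure (predict u \<mu>) (Ob j) = ennreal (p j \<mu> u)"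
proof -
  interpret P: prob_space "predict u \<mu>" by (rule predict_prob_space[OF assms])
  show ?thesis by (simp add: obs_prob_def P.emeasure_eq_measure)
qed

lemma p_sum:
  assumes "\<mu> \<in> space (prob_algebra S)" "u \<in> space Act"
  shows "(\<Sum>j\<in>classes. p j \<mu> u) = 1"
proof -
  interpret P: prob_space "predict u \<mu>" by (rule predict_prob_space[OF assms])
  have "(\<Sum>j\<in>classes. p j \<mu> u) = measure (predict u \<mu>) (\<Union>j\<in>classes. Ob j)"
    unfolding obs_prob_def using predict_prob_space[OF assms]
    by (intro P.finite_measure_finite_Union[symmetric] finite_classes Ob_disjoint) auto
  also have "\<dots> = 1"
    using P.prob_space predict_prob_space(3)[OF assms] by (simp add: Ob_cover)
  finally show ?thesis .
qed

lemma emeasure_\<Phi>_pos: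
  assumes "\<mu> \<in> space (prob_algebra S)" "u \<in> space Act" "C \<in> sets S" "p j \<mu> u > 0"
  shows "emeasure (\<Phi> \<rho> j \<mu> u) C = ennreal (1 / p j \<mu> u) * emeasure (predict u \<mu>) (C \<inter> Ob j)"
  using assms by (simp add: filter_map_def emeasure_restricted_op)

lemma emeasure_\<Phi>_Ob:
  assumes "admissible_family S classes Ob \<rho>" "j \<in> classes"
    and "\<mu> \<in> space (prob_algebra S)" "u \<in> space Act"
  shows "emeasure (\<Phi> \<rho> j \<mu> u) (Ob j) = 1"
proof (cases "p j \<mu> u > 0")
  case True
  then show ?thesis using assms
    by (simp add: emeasure_\<Phi>_pos emeasure_predict_Ob flip: ennreal_mult)
next
  case False
  then show ?thesis using assms by (simp add: filter_map_def admissible_family_def)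
qed

lemma \<Phi>_in_prob_algebra:
  assumes "admissible_family S classes Ob \<rho>" "j \<in> classes"
    and "\<mu> \<in> space (prob_algebra S)" "u \<in> space Act"
  shows "\<Phi> \<rho> j \<mu> u \<in> space (prob_algebra S)"
proof (cases "p j \<mu> u > 0")
  case True
  have sets: "sets (\<Phi> \<rho> j \<mu> u) = sets S"
    using True assms by (simp add: filter_map_def sets_restricted)
  then have sp: "space (\<Phi> \<rho> j \<mu> u) = space S" by (rule sets_eq_imp_space_eq)
  have "space S \<inter> Ob j = Ob j" using sets.sets_into_space[OF sets_Ob] by blast
  then have "prob_space (\<Phi> \<rho> j \<mu> u)" using True assms
    by (intro prob_spaceI) (simp add: sp emeasure_\<Phi>_pos emeasure_predict_Ob flip: ennreal_mult)
  with sets show ?thesis by (simp add: space_prob_algebra)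
next
  case False
  then show ?thesis using assms
    by (simp add: filter_map_def admissible_family_def)
qed

text \<open>Measurability into the space of probability measures is measurability of every
  evaluation, and an evaluation of the update is a quotient of two evaluations of the prediction
  where \<open>p\<close> is positive and constant elsewhere.\<close>

lemma measurable_\<Phi>:
  assumes adm: "admissible_family S classes Ob \<rho>" and j: "j \<in> classes"
  shows "(\<lambda>(\<mu>, u). \<Phi> \<rho> j \<mu> u) \<in> prob_algebra S \<Otimes>\<^sub>M Act \<rightarrow>\<^sub>M prob_algebra S"
proof -
  have in_prob: "(case z of (\<mu>, u) \<Rightarrow> \<Phi> \<rho> j \<mu> u) \<in> space (prob_algebra S)"
    if "z \<in> space (prob_algebra S \<Otimes>\<^sub>M Act)" for z
  proof -
    obtain \<mu> u where "z = (\<mu>, u)" by (cases z)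
    with that \<Phi>_in_prob_algebra[OF adm j, of \<mu> u] show ?thesis
      by (simp add: space_pair_measure)
  qed
  show ?thesis
  proof (intro measurable_prob_algebraI measurable_subprob_algebra)
    fix z assume z: "z \<in> space (prob_algebra S \<Otimes>\<^sub>M Act)"
    show "prob_space (case z of (\<mu>, u) \<Rightarrow> \<Phi> \<rho> j \<mu> u)"
      and "sets (case z of (\<mu>, u) \<Rightarrow> \<Phi> \<rho> j \<mu> u) = sets S"
      using in_prob[OF z] unfolding space_prob_algebra by blast+
    then show "subprob_space (case z of (\<mu>, u) \<Rightarrow> \<Phi> \<rho> j \<mu> u)"
      by (intro prob_space_imp_subprob_space)
  next
    fix C assume C [measurable]: "C \<in> sets S"
    define a where "a z = emeasure (case z of (\<mu>, u) \<Rightarrow> predict u \<mu>) (C \<inter> Ob j)" for z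
    define b where "b z = (case z of (\<mu>, u) \<Rightarrow> p j \<mu> u)" for z
    have [measurable]: "a \<in> borel_measurable (prob_algebra S \<Otimes>\<^sub>M Act)"
      unfolding a_def
      by (intro measurable_emeasure_kernel[OF measurable_prob_algebraD[OF measurable_predict]]) auto
    have [measurable]: "b \<in> borel_measurable (prob_algebra S \<Otimes>\<^sub>M Act)"
      unfolding b_def by (rule p_measurable)
    have "(\<lambda>z. if b z > 0 then ennreal (1 / b z) * a z else emeasure (\<rho> j) C)
        \<in> borel_measurable (prob_algebra S \<Otimes>\<^sub>M Act)"
      by measurable
    then show "(\<lambda>z. emeasure (case z of (\<mu>, u) \<Rightarrow> \<Phi> \<rho> j \<mu> u) C)
        \<in> borel_measurable (prob_algebra S \<Otimes>\<^sub>M Act)"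
      by (rule measurable_cong[THEN iffD1, rotated])
         (auto simp: space_pair_measure a_def b_def filter_map_def emeasure_restricted_op C)
  qed
qed

end

section \<open>Conditional laws\<close>

text \<open>Conditional laws in integrated form: the identity \<open>P(H \<inter> {Z \<in> C}) = E[1\<^sub>H \<kappa>(C)]\<close> over all
  events \<open>H\<close> of \<open>F\<close> replaces almost sure equality with a conditional expectation, so that no
  exceptional null sets have to be tracked through the induction over time.  The preimage needs no
  intersection with the carrier because \<open>H\<close> is contained in it.\<close>

definition cond_law ::
  "'w measure \<Rightarrow> 'w measure \<Rightarrow> 'x measure \<Rightarrow> ('w \<Rightarrow> 'x) \<Rightarrow> ('w \<Rightarrow> 'x measure) \<Rightarrow> bool" where
  "cond_law M F N Z \<kappa> \<longleftrightarrow>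
     \<kappa> \<in> F \<rightarrow>\<^sub>M prob_algebra N \<and>
     (\<forall>H\<in>sets F. \<forall>C\<in>sets N.
        emeasure M (H \<inter> Z -` C) = (\<integral>\<^sup>+\<omega>. indicator H \<omega> * emeasure (\<kappa> \<omega>) C \<partial>M))"

text \<open>The defining identity on rectangles says that the joint law of the outcome, seen through
  \<open>F\<close>, and of \<open>Z\<close> agrees with the mixture of the kernel \<open>\<kappa>\<close> over the outcome.  Rectangles generate
  the product \<open>\<sigma>\<close>-algebra and are stable under intersection, so the two measures, and with them
  all their integrals, coincide.\<close>

lemma cond_law_nn_integral:
  assumes M: "prob_space M" and sub: "subalgebra M F" and Z [measurable]: "Z \<in> M \<rightarrow>\<^sub>M N"
    and law: "cond_law M F N Z \<kappa>"
    and f [measurable]: "f \<in> borel_measurable (F \<Otimes>\<^sub>M N)"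
  shows "(\<integral>\<^sup>+\<omega>. f (\<omega>, Z \<omega>) \<partial>M) = (\<integral>\<^sup>+\<omega>. \<integral>\<^sup>+x. f (\<omega>, x) \<partial>\<kappa> \<omega> \<partial>M)"
proof -
  interpret prob_space M by fact
  have \<kappa>F: "\<kappa> \<in> F \<rightarrow>\<^sub>M prob_algebra N"
    and rect: "\<And>H C. H \<in> sets F \<Longrightarrow> C \<in> sets N \<Longrightarrow>
      emeasure M (H \<inter> Z -` C) = (\<integral>\<^sup>+\<omega>. indicator H \<omega> * emeasure (\<kappa> \<omega>) C \<partial>M)"
    using law by (auto simp: cond_law_def)
  have spF: "space F = space M" using sub by (simp add: subalgebra_def)
  have \<kappa>M [measurable]: "\<kappa> \<in> M \<rightarrow>\<^sub>M subprob_algebra N"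
    using measurable_prob_algebraD[OF \<kappa>F] sub by (rule measurable_from_subalg[rotated])
  have \<kappa>sp: "sets (\<kappa> \<omega>) = sets N" "space (\<kappa> \<omega>) = space N" if "\<omega> \<in> space M" for \<omega>
    using measurable_space[OF \<kappa>M that] by (auto simp: space_subprob_algebra dest: sets_eq_imp_space_eq)
  have idF [measurable]: "(\<lambda>\<omega>. \<omega>) \<in> M \<rightarrow>\<^sub>M F"
    using sub by (auto simp: measurable_def subalgebra_def)
  have pairZ [measurable]: "(\<lambda>\<omega>. (\<omega>, Z \<omega>)) \<in> M \<rightarrow>\<^sub>M F \<Otimes>\<^sub>M N"
    by measurable
  have pair [measurable]: "Pair \<omega> \<in> \<kappa> \<omega> \<rightarrow>\<^sub>M F \<Otimes>\<^sub>M N" if "\<omega> \<in> space M" for \<omega>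
    using that measurable_Pair1'[of \<omega> F N] \<kappa>sp(1)[OF that] by (simp add: spF cong: measurable_cong_sets)
  define K where "K \<omega> = distr (\<kappa> \<omega>) (F \<Otimes>\<^sub>M N) (Pair \<omega>)" for \<omega>
  have "(\<lambda>z. (fst z, snd z)) \<in> M \<Otimes>\<^sub>M N \<rightarrow>\<^sub>M F \<Otimes>\<^sub>M N"
    by (intro measurable_Pair measurable_compose[OF measurable_fst idF] measurable_snd)
  then have K [measurable]: "K \<in> M \<rightarrow>\<^sub>M subprob_algebra (F \<Otimes>\<^sub>M N)"
    unfolding K_def by (intro measurable_distr2[where M=N] \<kappa>M) simp
  have "distr M (F \<Otimes>\<^sub>M N) (\<lambda>\<omega>. (\<omega>, Z \<omega>)) = M \<bind> K" (is "?L = ?R")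
  proof (rule measure_eqI_generator_eq)
    let ?E = "{H \<times> C |H C. H \<in> sets F \<and> C \<in> sets N}"
    show "Int_stable ?E" by (rule Int_stable_pair_measure_generator)
    show "?E \<subseteq> Pow (space F \<times> space N)"
      using sets.space_closed[of F] sets.space_closed[of N] by blast
    show "sets ?L = sigma_sets (space F \<times> space N) ?E"
      by (simp add: sets_pair_measure)
    show "sets ?R = sigma_sets (space F \<times> space N) ?E"
      using sets_bind[OF sets_kernel[OF K] not_empty] by (simp add: sets_pair_measure)
    show "range (\<lambda>_::nat. space F \<times> space N) \<subseteq> ?E" by auto
    show "(\<Union>i::nat. space F \<times> space N) = space F \<times> space N" by simp
    show "emeasure ?L (space F \<times> space N) \<noteq> \<infinity>"
      using prob_space.emeasure_space_1[OF prob_space_distr[OF pairZ]] by (simp add: space_pair_measure)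
    fix Q assume "Q \<in> ?E"
    then obtain H C where Q: "Q = H \<times> C" and H [measurable]: "H \<in> sets F" and C [measurable]: "C \<in> sets N"
      by blast
    have "emeasure ?L Q = emeasure M (H \<inter> Z -` C)"
      using sets.sets_into_space[OF H]
      by (auto simp: emeasure_distr Q spF intro!: arg_cong[where f="emeasure M"])
    also have "\<dots> = (\<integral>\<^sup>+\<omega>. indicator H \<omega> * emeasure (\<kappa> \<omega>) C \<partial>M)"
      by (rule rect) fact+
    also have "\<dots> = (\<integral>\<^sup>+\<omega>. emeasure (K \<omega>) Q \<partial>M)"
    proof (rule nn_integral_cong)
      fix \<omega> assume \<omega>: "\<omega> \<in> space M"
      have "Pair \<omega> -` (H \<times> C) \<inter> space (\<kappa> \<omega>) = (if \<omega> \<in> H then C else {})"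
        using sets.sets_into_space[OF C] \<kappa>sp(2)[OF \<omega>] by auto
      then show "indicator H \<omega> * emeasure (\<kappa> \<omega>) C = emeasure (K \<omega>) Q"
        by (simp add: K_def emeasure_distr[OF pair[OF \<omega>]] Q)
    qed
    also have "\<dots> = emeasure ?R Q"
      by (rule emeasure_bind[OF not_empty K, symmetric]) (simp add: Q)
    finally show "emeasure ?L Q = emeasure ?R Q" .
  qed
  then have "(\<integral>\<^sup>+z. f z \<partial>distr M (F \<Otimes>\<^sub>M N) (\<lambda>\<omega>. (\<omega>, Z \<omega>))) = (\<integral>\<^sup>+z. f z \<partial>(M \<bind> K))" by simp
  moreover have "(\<integral>\<^sup>+z. f z \<partial>distr M (F \<Otimes>\<^sub>M N) (\<lambda>\<omega>. (\<omega>, Z \<omega>))) = (\<integral>\<^sup>+\<omega>. f (\<omega>, Z \<omega>) \<partial>M)"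
    by (simp add: nn_integral_distr[OF pairZ])
  moreover have "(\<integral>\<^sup>+z. f z \<partial>(M \<bind> K)) = (\<integral>\<^sup>+\<omega>. \<integral>\<^sup>+z. f z \<partial>K \<omega> \<partial>M)"
    by (rule nn_integral_bind[OF f K])
  moreover have "\<dots> = (\<integral>\<^sup>+\<omega>. \<integral>\<^sup>+x. f (\<omega>, x) \<partial>\<kappa> \<omega> \<partial>M)"
    unfolding K_def by (intro nn_integral_cong) (simp add: nn_integral_distr[OF pair])
  ultimately show ?thesis by simp
qed

lemma regular_cond_law_imp_cond_law:
  assumes M: "prob_space M" and sub: "subalgebra M F" and Z [measurable]: "Z \<in> M \<rightarrow>\<^sub>M N"
    and law: "regular_cond_law M F N Z \<kappa>"
  shows "cond_law M F N Z \<kappa>"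
proof -
  interpret prob_space M by fact
  interpret finite_measure_subalgebra M F by standard (rule sub)
  have \<kappa>F: "\<kappa> \<in> F \<rightarrow>\<^sub>M prob_algebra N" using law by (simp add: regular_cond_law_def)
  then have \<kappa>M [measurable]: "\<kappa> \<in> M \<rightarrow>\<^sub>M prob_algebra N" by (rule measurable_from_subalg[OF sub])
  have "emeasure M (H \<inter> Z -` C) = (\<integral>\<^sup>+\<omega>. indicator H \<omega> * emeasure (\<kappa> \<omega>) C \<partial>M)"
    if H: "H \<in> sets F" and C [measurable]: "C \<in> sets N" for H C
  proof -
    have HM [measurable]: "H \<in> sets M" using H sub by (auto simp: subalgebra_def)
    have \<kappa>: "prob_space (\<kappa> \<omega>)" if "\<omega> \<in> space M" for \<omega>
      using measurable_space[OF \<kappa>M that] by (simp add: space_prob_algebra)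
    let ?Z = "Z -` C \<inter> space M"
    have Zs [measurable]: "?Z \<in> sets M" by measurable
    have intZ: "integrable M (indicator ?Z :: _ \<Rightarrow> real)"
      by (rule integrable_real_indicator) (simp_all add: less_top[symmetric])
    have ind_meas [measurable]: "(\<lambda>\<omega>. measure (\<kappa> \<omega>) C) \<in> borel_measurable M" by measurable
    have "H \<inter> Z -` C = H \<inter> ?Z" using sets.sets_into_space[OF HM] by blast
    then have "emeasure M (H \<inter> Z -` C) = ennreal (measure M (H \<inter> ?Z))"
      by (simp add: emeasure_eq_measure)
    also have "measure M (H \<inter> ?Z) = (\<integral>\<omega>. indicator H \<omega> * indicator ?Z \<omega> \<partial>M)"
      by (simp flip: indicator_inter_arith)
    also have "\<dots> = (\<integral>\<omega>. indicator H \<omega> * real_cond_exp M F (indicator ?Z) \<omega> \<partial>M)"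
      using real_cond_exp_intA[OF intZ H] by (simp add: set_lebesgue_integral_def)
    also have "\<dots> = (\<integral>\<omega>. indicator H \<omega> * measure (\<kappa> \<omega>) C \<partial>M)"
    proof (rule integral_cong_AE)
      show "AE \<omega> in M. indicator H \<omega> * real_cond_exp M F (indicator ?Z) \<omega> = indicator H \<omega> * measure (\<kappa> \<omega>) C"
      proof (rule eventually_mono)
        show "AE \<omega> in M. measure (\<kappa> \<omega>) C = real_cond_exp M F (indicator ?Z) \<omega>"
          using law C unfolding regular_cond_law_def by blast
      qed simp
    qed measurable
    also have "ennreal \<dots> = (\<integral>\<^sup>+\<omega>. ennreal (indicator H \<omega> * measure (\<kappa> \<omega>) C) \<partial>M)"
    proof (rule nn_integral_eq_integral[symmetric])
      have "norm (indicator H \<omega> * measure (\<kappa> \<omega>) C) \<le> 1" if "\<omega> \<in> space M" for \<omega>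
        using prob_space.prob_le_1[OF \<kappa>[OF that]] by (simp add: indicator_def)
      then show "integrable M (\<lambda>\<omega>. indicator H \<omega> * measure (\<kappa> \<omega>) C)"
        by (intro integrable_const_bound[where B=1] AE_I2) measurable
    qed simp
    also have "\<dots> = (\<integral>\<^sup>+\<omega>. indicator H \<omega> * emeasure (\<kappa> \<omega>) C \<partial>M)"
    proof (rule nn_integral_cong)
      fix \<omega> assume "\<omega> \<in> space M"
      then interpret \<kappa>: prob_space "\<kappa> \<omega>" by (rule \<kappa>)
      show "ennreal (indicator H \<omega> * measure (\<kappa> \<omega>) C) = indicator H \<omega> * emeasure (\<kappa> \<omega>) C"
        by (simp add: \<kappa>.emeasure_eq_measure split: split_indicator)
    qed
    finally show ?thesis .
  qed
  with \<kappa>F show ?thesis by (simp add: cond_law_def)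
qed

section \<open>Independence of the noises from the past\<close>

lemma measurable_sigma_generated:
  assumes "\<G> \<subseteq> Pow \<Omega>" "\<And>B. B \<in> sets N \<Longrightarrow> f -` B \<inter> \<Omega> \<in> \<G>" "f \<in> \<Omega> \<rightarrow> space N"
  shows "f \<in> sigma \<Omega> \<G> \<rightarrow>\<^sub>M N"
  using assms by (intro measurableI) (auto simp: space_measure_of sets_measure_of)

text \<open>The labels of the independent random inputs: the initial state, and one value of each
  noise per time.  A single index type lets the past and the next step be treated as two disjoint
  blocks of one independent family.\<close>

datatype source = Start | Eta nat | Eps nat

text \<open>A finite cylinder event of an independent sequence belongs to the \<open>\<sigma>\<close>-algebra of the
  sequence as one random element, and its probability factorises.  The intersection with the
  carrier gives the right meaning to an empty set of times.\<close>

lemma (in prob_space) indep_vars_path: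
  fixes \<xi> :: "nat \<Rightarrow> 'a \<Rightarrow> 'b"
  assumes iv: "indep_vars (\<lambda>_. N) \<xi> T"
    and K: "finite K" "K \<subseteq> T"
    and A: "\<And>t. t \<in> K \<Longrightarrow> A t \<in> {\<xi> t -` B \<inter> space M |B. B \<in> sets N}"
  shows "space M \<inter> (\<Inter>t\<in>K. A t) \<in> sets (vimage_algebra (space M) (\<lambda>\<omega>. \<lambda>t\<in>T. \<xi> t \<omega>) (\<Pi>\<^sub>M t\<in>T. N))"
    and "prob (space M \<inter> (\<Inter>t\<in>K. A t)) = (\<Prod>t\<in>K. prob (A t))"
proof -
  let ?P = "vimage_algebra (space M) (\<lambda>\<omega>. \<lambda>t\<in>T. \<xi> t \<omega>) (\<Pi>\<^sub>M t\<in>T. N)"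
  have rv: "random_variable N (\<xi> t)" if "t \<in> T" for t
    using iv that by (simp add: indep_vars_def)
  have path: "(\<lambda>\<omega>. \<lambda>t\<in>T. \<xi> t \<omega>) \<in> ?P \<rightarrow>\<^sub>M (\<Pi>\<^sub>M t\<in>T. N)"
    using measurable_space[OF rv]
    by (intro measurable_vimage_algebra1) (auto simp: space_PiM)
  have \<xi>P: "\<xi> t \<in> ?P \<rightarrow>\<^sub>M N" if "t \<in> T" for t
    using measurable_compose[OF path measurable_component_singleton[OF that]] that by simp
  have AP: "A t \<in> sets ?P" if t: "t \<in> K" for t
  proof -
    obtain B where "B \<in> sets N" "A t = \<xi> t -` B \<inter> space M" using A[OF t] by blast
    with measurable_sets[OF \<xi>P, of t B] K t show ?thesis by auto
  qed
  show "space M \<inter> (\<Inter>t\<in>K. A t) \<in> sets ?P"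
  proof (cases "K = {}")
    case True
    then show ?thesis using sets.top[of ?P] by simp
  next
    case False
    then have "(\<Inter>t\<in>K. A t) \<in> sets ?P" using K AP by (intro sets.finite_INT) auto
    then show ?thesis using sets.Int[OF sets.top[of ?P]] by simp
  qed
  show "prob (space M \<inter> (\<Inter>t\<in>K. A t)) = (\<Prod>t\<in>K. prob (A t))"
  proof (cases "K = {}")
    case True
    then show ?thesis by (simp add: prob_space)
  next
    case False
    then have "(\<Inter>t\<in>K. A t) \<subseteq> space M" using A by blast
    then have "space M \<inter> (\<Inter>t\<in>K. A t) = (\<Inter>t\<in>K. A t)" by blast
    moreover have "prob (\<Inter>t\<in>K. A t) = (\<Prod>t\<in>K. prob (A t))"
      using iv K A False unfolding indep_vars_def2
      by (intro indep_setsD[where F="\<lambda>i. {\<xi> i -` A \<inter> space M |A. A \<in> sets N}" and I=T]) auto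
    ultimately show ?thesis by simp
  qed
qed

context controlled_process
begin

definition source_events :: "source \<Rightarrow> 'w set set" where
  "source_events s = (case s of
     Start \<Rightarrow> {X 0 -` B \<inter> space M |B. B \<in> sets S}
   | Eta t \<Rightarrow> {\<eta> t -` B \<inter> space M |B. B \<in> sets E}
   | Eps t \<Rightarrow> {\<epsilon> t -` B \<inter> space M |B. B \<in> sets V})"

lemma noise_measurable:
  assumes "t \<ge> 1"
  shows "\<eta> t \<in> M \<rightarrow>\<^sub>M E" "\<epsilon> t \<in> M \<rightarrow>\<^sub>M V"
  using iid_\<eta>(1) iid_\<epsilon>(1) assms by (auto simp: indep_vars_def)

lemma Int_stable_source_events: "Int_stable (source_events s)"
proof -
  have *: "Int_stable {f -` B \<inter> space M |B. B \<in> sets N}" for f :: "'w \<Rightarrow> 'z" and N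
  proof (rule Int_stableI)
    fix a b assume "a \<in> {f -` B \<inter> space M |B. B \<in> sets N}" "b \<in> {f -` B \<inter> space M |B. B \<in> sets N}"
    then obtain A B where "a = f -` A \<inter> space M" "b = f -` B \<inter> space M" "A \<in> sets N" "B \<in> sets N"
      by blast
    then have "a \<inter> b = f -` (A \<inter> B) \<inter> space M" "A \<inter> B \<in> sets N" by auto
    then show "a \<inter> b \<in> {f -` B \<inter> space M |B. B \<in> sets N}" by blast
  qed
  show ?thesis by (cases s) (simp_all add: source_events_def *)
qed

definition sources :: "source set" where
  "sources = {Start} \<union> Eta ` {1..} \<union> Eps ` {1..}"

lemma source_events_subset: "s \<in> sources \<Longrightarrow> source_events s \<subseteq> events"
  using X_0 noise_measurable
  by (auto simp: sources_def source_events_def intro!: measurable_sets)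

text \<open>Independence between the initial state and the two whole noise sequences combines with
  independence within each sequence: a finite intersection of source events is first split into its
  three parts, each part being an event of one of the three jointly independent \<open>\<sigma>\<close>-algebras, and
  then the parts that belong to a noise sequence are factorised further.\<close>

lemma indep_sources: "indep_sets source_events sources"
proof (rule indep_setsI)
  show "source_events s \<subseteq> events" if "s \<in> sources" for s
    using that by (rule source_events_subset)
next
  fix A K assume K: "K \<noteq> {}" "K \<subseteq> sources" "finite K"
    and A: "\<forall>k\<in>K. A k \<in> source_events k"
  define K1 where "K1 = {t. Eta t \<in> K}"
  define K2 where "K2 = {t. Eps t \<in> K}"
  have Ksplit: "K = (K \<inter> {Start}) \<union> Eta ` K1 \<union> Eps ` K2"
    using K(2) by (auto simp: K1_def K2_def sources_def)
  have fin: "finite K1" "finite K2"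
  proof -
    have "finite (Eta ` K1)" "finite (Eps ` K2)"
      using K(3) by (auto simp: K1_def K2_def intro: finite_subset[OF _ K(3)])
    then show "finite K1" "finite K2" by (auto dest!: finite_imageD simp: inj_on_def)
  qed
  have pos: "K1 \<subseteq> {1..}" "K2 \<subseteq> {1..}" using K(2) by (auto simp: K1_def K2_def sources_def)
  \<comment> \<open>a part that is absent from the intersection is represented by the sure event\<close>
  define B0 where "B0 = (if Start \<in> K then A Start else space M)"
  define B1 where "B1 = space M \<inter> (\<Inter>t\<in>K1. A (Eta t))"
  define B2 where "B2 = space M \<inter> (\<Inter>t\<in>K2. A (Eps t))"
  have A1: "A (Eta t) \<in> {\<eta> t -` B \<inter> space M |B. B \<in> sets E}" if "t \<in> K1" for t
    using A that by (auto simp: K1_def source_events_def)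
  have A2: "A (Eps t) \<in> {\<epsilon> t -` B \<inter> space M |B. B \<in> sets V}" if "t \<in> K2" for t
    using A that by (auto simp: K2_def source_events_def)
  note B1 = indep_vars_path[OF iid_\<eta>(1) fin(1) pos(1), of "\<lambda>t. A (Eta t)", OF A1, folded B1_def]
  note B2 = indep_vars_path[OF iid_\<epsilon>(1) fin(2) pos(2), of "\<lambda>t. A (Eps t)", OF A2, folded B2_def]
  have B0: "B0 \<in> sets (vimage_algebra (space M) (X 0) S)"
  proof (cases "Start \<in> K")
    case True
    then have "A Start \<in> {X 0 -` B \<inter> space M |B. B \<in> sets S}"
      using A by (auto simp: source_events_def)
    then show ?thesis using True by (auto simp: B0_def sets_vimage_algebra)
  next
    case False
    then show ?thesis by (simp add: B0_def sets_vimage_algebra_space)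
  qed
  have "A k \<subseteq> space M" if "k \<in> K" for k
    using A that source_events_subset K(2) sets.sets_into_space by blast
  then have "(\<Inter>k\<in>K. A k) = (space M \<inter> (\<Inter>k\<in>K. A k))"
    using K(1) by blast
  also have "\<dots> = B0 \<inter> B1 \<inter> B2"
    by (subst Ksplit) (auto simp: B0_def B1_def B2_def)
  finally have Int: "(\<Inter>k\<in>K. A k) = B0 \<inter> B1 \<inter> B2" .
  have three: "{..<3} = {0, 1, 2::nat}" by auto
  have "prob (\<Inter>i\<in>{..<3}. [B0, B1, B2] ! i) = (\<Prod>i\<in>{..<3}. prob ([B0, B1, B2] ! i))"
    by (rule indep_setsD[OF indep]) (use B0 B1(1) B2(1) in \<open>auto simp: three numeral_2_eq_2\<close>)
  then have "prob (B0 \<inter> B1 \<inter> B2) = prob B0 * prob B1 * prob B2"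
    by (simp add: three numeral_2_eq_2 Int_assoc mult.assoc)
  also have "\<dots> = (\<Prod>k\<in>K \<inter> {Start}. prob (A k)) * (\<Prod>k\<in>Eta ` K1. prob (A k)) * (\<Prod>k\<in>Eps ` K2. prob (A k))"
    by (simp add: B1(2) B2(2) prod.reindex inj_on_def B0_def prob_space)
  also have "\<dots> = (\<Prod>k\<in>K. prob (A k))"
  proof -
    have "(\<Prod>k\<in>(K \<inter> {Start}) \<union> Eta ` K1 \<union> Eps ` K2. prob (A k)) =
        (\<Prod>k\<in>(K \<inter> {Start}) \<union> Eta ` K1. prob (A k)) * (\<Prod>k\<in>Eps ` K2. prob (A k))"
      using fin by (intro prod.union_disjoint) auto
    also have "(\<Prod>k\<in>(K \<inter> {Start}) \<union> Eta ` K1. prob (A k)) =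
        (\<Prod>k\<in>K \<inter> {Start}. prob (A k)) * (\<Prod>k\<in>Eta ` K1. prob (A k))"
      using fin by (intro prod.union_disjoint) auto
    finally show ?thesis using Ksplit by simp
  qed
  finally show "prob (\<Inter>k\<in>K. A k) = (\<Prod>k\<in>K. prob (A k))" by (simp add: Int)
qed

definition sources_until :: "nat \<Rightarrow> source set" where
  "sources_until t = {Start} \<union> Eta ` {1..t} \<union> Eps ` {1..t}"

text \<open>What the inputs up to time \<open>t\<close> determine.  It contains all the information that is observed
  up to time \<open>t\<close> and determines the state at that time as well.\<close>

definition past :: "nat \<Rightarrow> 'w measure" where
  "past t = sigma (space M) (\<Union>s\<in>sources_until t. source_events s)"

abbreviation next_noise :: "nat \<Rightarrow> 'w \<Rightarrow> 'e \<times> 'v" where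
  "next_noise t \<omega> \<equiv> (\<eta> (Suc t) \<omega>, \<epsilon> (Suc t) \<omega>)"

lemma sources_until_subset: "sources_until t \<subseteq> sources"
  by (auto simp: sources_until_def sources_def)

lemma past_gen: "(\<Union>s\<in>sources_until t. source_events s) \<subseteq> Pow (space M)"
  using source_events_subset sources_until_subset sets.sets_into_space by blast

lemma space_past [simp]: "space (past t) = space M"
  by (simp add: past_def space_measure_of[OF past_gen])

lemma sets_past: "sets (past t) = sigma_sets (space M) (\<Union>s\<in>sources_until t. source_events s)"
  by (simp add: past_def sets_measure_of[OF past_gen])

lemma subalgebra_past: "subalgebra M (past t)"
  unfolding subalgebra_def sets_past
  using source_events_subset sources_until_subset
  by (auto intro!: sets.sigma_sets_subset)

lemma measurable_past:
  assumes s: "s \<in> sources_until t" and f: "f \<in> M \<rightarrow>\<^sub>M N"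
    and gen: "\<And>B. B \<in> sets N \<Longrightarrow> f -` B \<inter> space M \<in> source_events s"
  shows "f \<in> past t \<rightarrow>\<^sub>M N"
  unfolding past_def
proof (rule measurable_sigma_generated[OF past_gen])
  show "f \<in> space M \<rightarrow> space N" using measurable_space[OF f] by blast
  show "f -` B \<inter> space M \<in> (\<Union>s\<in>sources_until t. source_events s)" if "B \<in> sets N" for B
    using gen[OF that] s by blast
qed

lemma sets_past_mono: "s \<le> t \<Longrightarrow> sets (past s) \<subseteq> sets (past t)"
  unfolding sets_past by (intro sigma_sets_mono') (auto simp: sources_until_def)

lemma next_noise_measurable [measurable]: "next_noise t \<in> M \<rightarrow>\<^sub>M E \<Otimes>\<^sub>M V"
  using noise_measurable[of "Suc t"] by (intro measurable_Pair) simp_all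

text \<open>The two noises of one step are independent of each other, so their joint law is the
  product of the individual laws.\<close>

lemma next_noise_law: "distr M (E \<Otimes>\<^sub>M V) (next_noise t) = noise"
proof (rule pair_measure_eqI[symmetric])
  show "sigma_finite_measure \<nu>E" "sigma_finite_measure \<nu>V"
    using prob_space_noise_laws by (auto intro: prob_space_imp_sigma_finite)
  show "sets noise = sets (distr M (E \<Otimes>\<^sub>M V) (next_noise t))"
    by (simp add: sets_noise_laws cong: sets_pair_measure_cong)
  fix B C assume "B \<in> sets \<nu>E" "C \<in> sets \<nu>V"
  then have B: "B \<in> sets E" and C: "C \<in> sets V" by (simp_all add: sets_noise_laws)
  let ?B = "\<eta> (Suc t) -` B \<inter> space M" and ?C = "\<epsilon> (Suc t) -` C \<inter> space M"
  \<comment> \<open>the two events indexed by their sources; the value at \<open>Start\<close> is arbitrary\<close>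
  let ?Q = "case_source {} (\<lambda>_. ?B) (\<lambda>_. ?C)"
  have "prob (\<Inter>s\<in>{Eta (Suc t), Eps (Suc t)}. ?Q s) = (\<Prod>s\<in>{Eta (Suc t), Eps (Suc t)}. prob (?Q s))"
    by (rule indep_setsD[OF indep_sources]) (use B C in \<open>auto simp: sources_def source_events_def\<close>)
  then have "emeasure M (?B \<inter> ?C) = emeasure M ?B * emeasure M ?C"
    by (simp add: emeasure_eq_measure ennreal_mult)
  moreover have "emeasure \<nu>E B = emeasure M ?B"
    using B noise_measurable(1)[of "Suc t"] by (simp add: emeasure_distr flip: iid_\<eta>(2)[of "Suc t"])
  moreover have "emeasure \<nu>V C = emeasure M ?C"
    using C noise_measurable(2)[of "Suc t"] by (simp add: emeasure_distr flip: iid_\<epsilon>(2)[of "Suc t"])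
  moreover have "next_noise t -` (B \<times> C) \<inter> space M = ?B \<inter> ?C" by auto
  ultimately show "emeasure \<nu>E B * emeasure \<nu>V C = emeasure (distr M (E \<Otimes>\<^sub>M V) (next_noise t)) (B \<times> C)"
    using B C by (simp add: emeasure_distr[OF next_noise_measurable])
qed

text \<open>The inputs up to time \<open>t\<close> and those of time \<open>t + 1\<close> are disjoint blocks of an independent
  family.\<close>

lemma next_noise_cond_law: "cond_law M (past t) (E \<Otimes>\<^sub>M V) (next_noise t) (\<lambda>_. noise)"
  unfolding cond_law_def
proof (intro conjI ballI)
  show "(\<lambda>_. noise) \<in> past t \<rightarrow>\<^sub>M prob_algebra (E \<Otimes>\<^sub>M V)" by measurable
  fix H D assume H: "H \<in> sets (past t)" and D: "D \<in> sets (E \<Otimes>\<^sub>M V)"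
  have HM [measurable]: "H \<in> sets M" using H subalgebra_past by (auto simp: subalgebra_def)
  let ?next = "{Eta (Suc t), Eps (Suc t)}"
  let ?I = "case_bool (sources_until t) ?next"
  have sub: "(\<Union>b\<in>UNIV. ?I b) \<subseteq> sources"
    using sources_until_subset[of t] by (auto simp: sources_def split: bool.splits)
  have "indep_sets (\<lambda>b. sigma_sets (space M) (\<Union>i\<in>?I b. source_events i)) UNIV"
    by (rule indep_sets_collect_sigma[OF indep_sets_mono_index[OF sub indep_sources]])
       (auto simp: Int_stable_source_events disjoint_family_on_def sources_until_def split: bool.splits)
  also have "(\<lambda>b. sigma_sets (space M) (\<Union>i\<in>?I b. source_events i)) =
    case_bool (sets (past t)) (sigma_sets (space M) (\<Union>i\<in>?next. source_events i))"
    by (auto simp: fun_eq_iff sets_past split: bool.split)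
  finally have ind: "indep_set (sets (past t)) (sigma_sets (space M) (\<Union>i\<in>?next. source_events i))"
    unfolding indep_set_def .
  let ?F = "sigma (space M) (\<Union>i\<in>?next. source_events i)"
  have gen: "(\<Union>i\<in>?next. source_events i) \<subseteq> Pow (space M)"
    by (auto simp: source_events_def)
  have "\<eta> (Suc t) \<in> ?F \<rightarrow>\<^sub>M E" "\<epsilon> (Suc t) \<in> ?F \<rightarrow>\<^sub>M V"
    using noise_measurable[of "Suc t", THEN measurable_space]
    by (intro measurable_sigma_generated[OF gen]; force simp: source_events_def)+
  then have "next_noise t \<in> ?F \<rightarrow>\<^sub>M E \<Otimes>\<^sub>M V" by (rule measurable_Pair)
  from measurable_sets[OF this D]
  have "next_noise t -` D \<inter> space M \<in> sigma_sets (space M) (\<Union>i\<in>?next. source_events i)"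
    unfolding space_measure_of[OF gen] sets_measure_of[OF gen] .
  from indep_setD[OF ind H this]
  have "prob (H \<inter> (next_noise t -` D \<inter> space M)) = prob H * prob (next_noise t -` D \<inter> space M)" .
  moreover have "H \<inter> (next_noise t -` D \<inter> space M) = H \<inter> next_noise t -` D"
    using sets.sets_into_space[OF HM] by blast
  ultimately have "emeasure M (H \<inter> next_noise t -` D) = emeasure M H * emeasure M (next_noise t -` D \<inter> space M)"
    by (simp add: emeasure_eq_measure ennreal_mult)
  also have "emeasure M (next_noise t -` D \<inter> space M) = emeasure noise D"
    using emeasure_distr[OF next_noise_measurable D] by (simp add: next_noise_law)
  finally show "emeasure M (H \<inter> next_noise t -` D) = (\<integral>\<^sup>+\<omega>. indicator H \<omega> * emeasure noise D \<partial>M)"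
    by (simp add: nn_integral_multc)
qed

end

section \<open>The information available at each time\<close>

context controlled_process
begin

abbreviation info :: "nat \<Rightarrow> 'w measure" where "info \<equiv> info_algebra M Act Y U"

definition info_events :: "nat \<Rightarrow> 'w set set" where
  "info_events t =
     {Y s -` B \<inter> space M |s B. s \<le> t \<and> B \<in> sets (count_space UNIV)} \<union>
     {U s -` B \<inter> space M |s B. s < t \<and> B \<in> sets Act}"

lemma info_events_Pow: "info_events t \<subseteq> Pow (space M)"
  by (auto simp: info_events_def)

lemma space_info [simp]: "space (info t) = space M"
  unfolding info_algebra_def info_events_def[symmetric]
  by (rule space_measure_of[OF info_events_Pow])

lemma sets_info: "sets (info t) = sigma_sets (space M) (info_events t)"
  unfolding info_algebra_def info_events_def[symmetric]
  by (rule sets_measure_of[OF info_events_Pow])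

lemma sets_info_mono:
  assumes "s \<le> t"
  shows "sets (info s) \<subseteq> sets (info t)"
  unfolding sets_info
proof (rule sigma_sets_mono')
  show "info_events s \<subseteq> info_events t"
    unfolding info_events_def
    by (rule Un_mono; use assms in \<open>blast intro: order_trans order_less_le_trans\<close>)
qed

text \<open>Passing from time \<open>t\<close> to \<open>t + 1\<close> adds only the generators from \<open>Y (t + 1)\<close> and \<open>U t\<close>.\<close>

lemma info_events_SucE:
  assumes "H \<in> info_events (Suc t)"
  obtains "H \<in> info_events t" | B where "H = Y (Suc t) -` B \<inter> space M"
    | B where "H = U t -` B \<inter> space M" "B \<in> sets Act"
proof -
  from assms consider s B where "H = Y s -` B \<inter> space M" "s \<le> Suc t"
    | s B where "H = U s -` B \<inter> space M" "s < Suc t" "B \<in> sets Act"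
    unfolding info_events_def by blast
  then show thesis
  proof cases
    case (1 s B)
    have "H \<in> info_events t" if "s \<le> t" using 1 that by (auto simp: info_events_def)
    with 1 that show thesis by (auto simp: le_Suc_eq)
  next
    case (2 s B)
    have "H \<in> info_events t" if "s < t" using 2 that by (auto simp: info_events_def)
    with 2 that show thesis by (auto simp: less_Suc_eq)
  qed
qed

text \<open>An event about the observation is a finite union of events about the state, because
  every state lies in exactly one nonempty class.\<close>

lemma Y_preimage:
  assumes X: "X t \<in> F \<rightarrow>\<^sub>M S" and F: "space F = space M"
  shows "Y t -` B \<inter> space M \<in> sets F"
proof -
  have "Y t -` B \<inter> space M = (\<Union>j\<in>B \<inter> classes. X t -` Ob j \<inter> space F)"
  proof (intro set_eqI iffI)
    fix \<omega> assume \<omega>: "\<omega> \<in> Y t -` B \<inter> space M"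
    then have "X t \<omega> \<in> (\<Union>j\<in>classes. Ob j)"
      using measurable_space[OF X] F by (simp add: Ob_cover)
    then obtain j where j: "j \<in> classes" "X t \<omega> \<in> Ob j" by blast
    then have "Y t \<omega> = j" using Y_eq[of \<omega> j t] \<omega> by (auto simp: obs_indices_def)
    with j \<omega> F show "\<omega> \<in> (\<Union>j\<in>B \<inter> classes. X t -` Ob j \<inter> space F)" by auto
  next
    fix \<omega> assume "\<omega> \<in> (\<Union>j\<in>B \<inter> classes. X t -` Ob j \<inter> space F)"
    then show "\<omega> \<in> Y t -` B \<inter> space M"
      using Y_eq[of \<omega> _ t] F by (fastforce simp: obs_indices_def)
  qed
  also have "\<dots> \<in> sets F"
    using finite_classes X by (intro sets.finite_UN measurable_sets[OF X]) auto
  finally show ?thesis .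
qed

text \<open>The two claims need each other: the state at time \<open>t + 1\<close> depends on the control at time
  \<open>t\<close>, which is a function of the information at time \<open>t\<close>, and the information at time \<open>t + 1\<close> depends
  on that state.\<close>

lemma info_subset_past: "X t \<in> past t \<rightarrow>\<^sub>M S \<and> sets (info t) \<subseteq> sets (past t)"
proof (induction t)
  case 0
  have X: "X 0 \<in> past 0 \<rightarrow>\<^sub>M S"
    by (rule measurable_past[OF _ X_0, of Start]) (auto simp: sources_until_def source_events_def)
  moreover have "sets (info 0) \<subseteq> sets (past 0)"
    unfolding sets_info using Y_preimage[OF X]
    by (intro sets.sigma_sets_subset[of _ "past 0", simplified]) (auto simp: info_events_def)
  ultimately show ?case by blast
next
  case (Suc t)
  have le: "sets (past t) \<subseteq> sets (past (Suc t))" by (rule sets_past_mono) simp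
  have sub: "N1 \<in> past t \<rightarrow>\<^sub>M N \<Longrightarrow> N1 \<in> past (Suc t) \<rightarrow>\<^sub>M N" for N1 :: "'w \<Rightarrow> 'z" and N
    by (erule measurable_from_subalg[rotated]) (simp add: subalgebra_def le)
  have U_past: "U t \<in> past t \<rightarrow>\<^sub>M Act"
    using Suc U_adapted[of t] by (intro measurable_from_subalg[of "past t" "info t"]) (auto simp: subalgebra_def)
  have noise: "\<eta> (Suc t) \<in> past (Suc t) \<rightarrow>\<^sub>M E" "\<epsilon> (Suc t) \<in> past (Suc t) \<rightarrow>\<^sub>M V"
    by (rule measurable_past[OF _ noise_measurable(1), of "Eta (Suc t)"]
        measurable_past[OF _ noise_measurable(2), of "Eps (Suc t)"],
        auto simp: sources_until_def source_events_def)+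
  have X_past: "X t \<in> past t \<rightarrow>\<^sub>M S" using Suc by blast
  have "(\<lambda>\<omega>. G (X t \<omega>, U t \<omega>, \<eta> (Suc t) \<omega>, \<epsilon> (Suc t) \<omega>)) \<in> past (Suc t) \<rightarrow>\<^sub>M S"
    by (intro measurable_compose[OF _ measurable_G] measurable_Pair sub[OF U_past] sub[OF X_past] noise)
  then have X: "X (Suc t) \<in> past (Suc t) \<rightarrow>\<^sub>M S"
    by (rule measurable_cong[THEN iffD1, rotated]) (simp add: X_Suc)
  have "info_events (Suc t) \<subseteq> sets (past (Suc t))"
  proof
    fix H assume "H \<in> info_events (Suc t)"
    then show "H \<in> sets (past (Suc t))"
    proof (cases rule: info_events_SucE)
      case 1
      then have "H \<in> sets (info t)" by (simp add: sets_info)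
      with Suc le show ?thesis by blast
    next
      case 2
      then show ?thesis using Y_preimage[OF X] by simp
    next
      case 3
      then show ?thesis using measurable_sets[OF sub[OF U_past]] by simp
    qed
  qed
  then have "sets (info (Suc t)) \<subseteq> sets (past (Suc t))"
    unfolding sets_info by (intro sets.sigma_sets_subset[of _ "past (Suc t)", simplified])
  with X show ?case by blast
qed

lemma subalgebra_info_past: "subalgebra (past t) (info t)"
  using info_subset_past by (simp add: subalgebra_def)

lemma subalgebra_info: "subalgebra M (info t)"
  using subalgebra_info_past[of t] subalgebra_past[of t] by (auto simp: subalgebra_def)

lemma X_measurable [measurable]: "X t \<in> M \<rightarrow>\<^sub>M S"
  using info_subset_past subalgebra_past by (blast intro: measurable_from_subalg)

lemma Y_in_classes: "\<omega> \<in> space M \<Longrightarrow> Y t \<omega> \<in> classes"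
  and X_in_class: "\<omega> \<in> space M \<Longrightarrow> X t \<omega> \<in> Ob (Y t \<omega>)"
proof -
  assume \<omega>: "\<omega> \<in> space M"
  then have "X t \<omega> \<in> (\<Union>j\<in>classes. Ob j)"
    using measurable_space[OF X_measurable] by (simp add: Ob_cover)
  then obtain j where j: "j \<in> classes" "X t \<omega> \<in> Ob j" by blast
  then have "Y t \<omega> = j" using Y_eq[of \<omega> j t] \<omega> by (auto simp: obs_indices_def)
  with j show "Y t \<omega> \<in> classes" "X t \<omega> \<in> Ob (Y t \<omega>)" by simp_all
qed

lemma Y_eq_iff: "\<omega> \<in> space M \<Longrightarrow> j \<in> classes \<Longrightarrow> Y t \<omega> = j \<longleftrightarrow> X t \<omega> \<in> Ob j"
  using Y_eq[of \<omega> j t] by (auto simp: obs_indices_def)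

lemma Y_measurable_info: "Y t \<in> info t \<rightarrow>\<^sub>M count_space classes"
proof (rule measurableI)
  show "Y t \<omega> \<in> space (count_space classes)" if "\<omega> \<in> space (info t)" for \<omega>
    using that by (simp add: Y_in_classes)
  have "Y t -` B \<inter> space M \<in> info_events t" for B
    by (auto simp: info_events_def)
  then show "Y t -` B \<inter> space (info t) \<in> sets (info t)" for B
    by (simp add: sets_info sigma_sets.Basic)
qed

text \<open>The control \<open>U t\<close> is already determined by the information at time \<open>t\<close>, so the only new
  knowledge at time \<open>t + 1\<close> is the value of \<open>Y (t + 1)\<close>: an event at time \<open>t + 1\<close> is a choice of an
  event at time \<open>t\<close> for each possible value of that observation.\<close>

lemma info_Suc_decompose:
  assumes "H \<in> sets (info (Suc t))"
  shows "\<exists>h. (\<forall>j. h j \<in> sets (info t)) \<and> H = {\<omega>\<in>space M. \<omega> \<in> h (Y (Suc t) \<omega>)}"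
  using assms unfolding sets_info[of "Suc t"]
proof (induction rule: sigma_sets.induct)
  case (Basic H)
  then consider "H \<in> sets (info t)" | B where "H = Y (Suc t) -` B \<inter> space M"
    using measurable_sets[OF U_adapted[of t]]
    by (cases rule: info_events_SucE) (auto simp: sets_info[of t])
  then show ?case
  proof cases
    case 1
    then show ?thesis
      using sets.sets_into_space[OF 1] by (intro exI[of _ "\<lambda>_. H"]) auto
  next
    case (2 B)
    then show ?thesis
      using sets.top[of "info t"]
      by (intro exI[of _ "\<lambda>j. if j \<in> B then space M else {}"]) auto
  qed
next
  case Empty
  then show ?case by (intro exI[of _ "\<lambda>_. {}"]) auto
next
  case (Compl H)
  then obtain h where "\<And>j. h j \<in> sets (info t)" "H = {\<omega>\<in>space M. \<omega> \<in> h (Y (Suc t) \<omega>)}" by blast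
  then show ?case
    using sets.compl_sets[of _ "info t"]
    by (intro exI[of _ "\<lambda>j. space M - h j"]) auto
next
  case (Union H)
  then obtain h where h: "\<And>i j. h i j \<in> sets (info t)"
      "\<And>i::nat. H i = {\<omega>\<in>space M. \<omega> \<in> h i (Y (Suc t) \<omega>)}" by metis
  then show ?case
    by (intro exI[of _ "\<lambda>j. \<Union>i. h i j"]) auto
qed

section \<open>The recursion computes the conditional law of the state\<close>

lemma ctrl_kernel_measurable:
  assumes C [measurable]: "C \<in> sets S"
  shows "(\<lambda>(x, u). ctrl_kernel G \<nu>E \<nu>V C x u) \<in> borel_measurable (S \<Otimes>\<^sub>M Act)"
proof -
  interpret N: prob_space noise by (rule prob_space_noise_laws)
  note measurable_G [measurable]
  have "(\<lambda>z. \<integral>\<^sup>+n. indicator C (G (fst z, snd z, fst n, snd n)) \<partial>noise) \<in> borel_measurable (S \<Otimes>\<^sub>M Act)"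
    by measurable
  then show ?thesis
    by (rule measurable_cong[THEN iffD1, rotated])
       (auto simp: space_pair_measure ctrl_kernel_eq_noise_integral case_prod_unfold)
qed

text \<open>The next state is a function of the current state, the control and the fresh noises.
  Integrating out the noises, which are independent of the past, replaces the indicator of
  \<open>X (t + 1) \<in> C\<close> by the controlled kernel at \<open>(X t, U t)\<close>; integrating out \<open>X t\<close> against its
  conditional law then gives the prediction.\<close>

lemma predicted_cond_law:
  assumes law: "cond_law M (info t) S (X t) \<kappa>"
  shows "cond_law M (info t) S (X (Suc t)) (\<lambda>\<omega>. predict (U t \<omega>) (\<kappa> \<omega>))"
  unfolding cond_law_def
proof (intro conjI ballI)
  have \<kappa> [measurable]: "\<kappa> \<in> info t \<rightarrow>\<^sub>M prob_algebra S" using law by (simp add: cond_law_def)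
  note U_adapted [measurable]
  show "(\<lambda>\<omega>. predict (U t \<omega>) (\<kappa> \<omega>)) \<in> info t \<rightarrow>\<^sub>M prob_algebra S"
    using measurable_compose[OF measurable_Pair[OF \<kappa> U_adapted[of t]] measurable_predict] by simp
  fix H C assume H [measurable]: "H \<in> sets (info t)" and C [measurable]: "C \<in> sets S"
  have [measurable]: "H \<in> sets (past t)" and HM: "H \<in> sets M"
    using H subalgebra_info_past[of t] subalgebra_info[of t] by (auto simp: subalgebra_def)
  have XP [measurable]: "X t \<in> past t \<rightarrow>\<^sub>M S" using info_subset_past by blast
  have UP [measurable]: "U t \<in> past t \<rightarrow>\<^sub>M Act"
    using subalgebra_info_past U_adapted by (rule measurable_from_subalg)
  have Xs: "X t \<omega> \<in> space S" "U t \<omega> \<in> space Act" "\<kappa> \<omega> \<in> space (prob_algebra S)" if "\<omega> \<in> space M" for \<omega>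
    using that measurable_space[OF XP] measurable_space[OF UP] measurable_space[OF \<kappa>] by auto
  note measurable_G [measurable]
  let ?f = "\<lambda>(\<omega>, n). indicator H \<omega> * indicator C (G (X t \<omega>, U t \<omega>, fst n, snd n)) :: ennreal"
  let ?g = "\<lambda>(\<omega>, x). indicator H \<omega> * ctrl_kernel G \<nu>E \<nu>V C x (U t \<omega>)"
  have f: "?f \<in> borel_measurable (past t \<Otimes>\<^sub>M (E \<Otimes>\<^sub>M V))" by measurable
  have "(\<lambda>z. ctrl_kernel G \<nu>E \<nu>V C (snd z) (U t (fst z))) \<in> borel_measurable (info t \<Otimes>\<^sub>M S)"
    using measurable_compose[OF measurable_Pair[OF measurable_snd
        measurable_compose[OF measurable_fst U_adapted[of t]]] ctrl_kernel_measurable[OF C]]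
    by simp
  then have g: "?g \<in> borel_measurable (info t \<Otimes>\<^sub>M S)"
    by (simp add: case_prod_unfold)
  have HX: "H \<inter> X (Suc t) -` C = H \<inter> (X (Suc t) -` C \<inter> space M)"
    using sets.sets_into_space[OF HM] by blast
  have "emeasure M (H \<inter> X (Suc t) -` C) = (\<integral>\<^sup>+\<omega>. indicator (H \<inter> (X (Suc t) -` C \<inter> space M)) \<omega> \<partial>M)"
    unfolding HX by (rule nn_integral_indicator[symmetric])
      (intro sets.Int HM measurable_sets[OF X_measurable] C)
  also have "\<dots> = (\<integral>\<^sup>+\<omega>. ?f (\<omega>, next_noise t \<omega>) \<partial>M)"
    by (intro nn_integral_cong) (auto simp: X_Suc split: split_indicator)
  also have "\<dots> = (\<integral>\<^sup>+\<omega>. \<integral>\<^sup>+n. ?f (\<omega>, n) \<partial>noise \<partial>M)"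
    by (rule cond_law_nn_integral[OF prob_space_axioms subalgebra_past
          next_noise_measurable next_noise_cond_law f])
  also have "\<dots> = (\<integral>\<^sup>+\<omega>. ?g (\<omega>, X t \<omega>) \<partial>M)"
  proof (rule nn_integral_cong)
    fix \<omega> assume "\<omega> \<in> space M"
    note \<omega> = Xs[OF this]
    note \<omega>(1,2) [measurable]
    have "(\<lambda>n. indicator C (G (X t \<omega>, U t \<omega>, fst n, snd n)) :: ennreal) \<in> borel_measurable noise"
      by measurable
    then show "(\<integral>\<^sup>+n. ?f (\<omega>, n) \<partial>noise) = ?g (\<omega>, X t \<omega>)"
      using \<omega> by (simp add: nn_integral_cmult ctrl_kernel_eq_noise_integral case_prod_unfold)
  qed
  also have "\<dots> = (\<integral>\<^sup>+\<omega>. \<integral>\<^sup>+x. ?g (\<omega>, x) \<partial>\<kappa> \<omega> \<partial>M)"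
    by (rule cond_law_nn_integral[OF prob_space_axioms subalgebra_info X_measurable law g])
  also have "\<dots> = (\<integral>\<^sup>+\<omega>. indicator H \<omega> * emeasure (predict (U t \<omega>) (\<kappa> \<omega>)) C \<partial>M)"
  proof (rule nn_integral_cong)
    fix \<omega> assume "\<omega> \<in> space M"
    note \<omega> = Xs[OF this]
    have "sets (\<kappa> \<omega>) = sets S" using \<omega>(3) by (simp add: space_prob_algebra)
    moreover have "(\<lambda>x. ctrl_kernel G \<nu>E \<nu>V C x (U t \<omega>)) \<in> borel_measurable S"
      using measurable_compose[OF measurable_Pair2'[OF \<omega>(2), of S] ctrl_kernel_measurable[OF C]] by simp
    ultimately have "(\<lambda>x. ctrl_kernel G \<nu>E \<nu>V C x (U t \<omega>)) \<in> borel_measurable (\<kappa> \<omega>)"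
      by (simp cong: measurable_cong_sets)
    then show "(\<integral>\<^sup>+x. ?g (\<omega>, x) \<partial>\<kappa> \<omega>) = indicator H \<omega> * emeasure (predict (U t \<omega>) (\<kappa> \<omega>)) C"
      using \<omega> by (simp add: nn_integral_cmult emeasure_predict C)
  qed
  finally show "emeasure M (H \<inter> X (Suc t) -` C) =
    (\<integral>\<^sup>+\<omega>. indicator H \<omega> * emeasure (predict (U t \<omega>) (\<kappa> \<omega>)) C \<partial>M)" .
qed

text \<open>Bayes' rule without division.  Where \<open>p\<close> vanishes both sides are zero, whatever the
  fallback measure is; so the fallback disappears from every integrated identity.\<close>

lemma \<Phi>_mass_times_p:
  assumes "\<mu> \<in> space (prob_algebra S)" "u \<in> space Act" "C \<in> sets S"
  shows "emeasure (\<Phi> \<rho> j \<mu> u) C * ennreal (p j \<mu> u) = emeasure (predict u \<mu>) (C \<inter> Ob j)"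
proof (cases "p j \<mu> u > 0")
  case True
  have "emeasure (\<Phi> \<rho> j \<mu> u) C * ennreal (p j \<mu> u) =
      (ennreal (1 / p j \<mu> u) * ennreal (p j \<mu> u)) * emeasure (predict u \<mu>) (C \<inter> Ob j)"
    using True assms by (simp add: emeasure_\<Phi>_pos ac_simps)
  also have "ennreal (1 / p j \<mu> u) * ennreal (p j \<mu> u) = 1"
    using True by (simp flip: ennreal_mult)
  finally show ?thesis by simp
next
  case False
  have "p j \<mu> u \<ge> 0" by (simp add: obs_prob_def)
  with False have p0: "p j \<mu> u = 0" by simp
  have "emeasure (predict u \<mu>) (C \<inter> Ob j) \<le> emeasure (predict u \<mu>) (Ob j)"
    using predict_prob_space(2)[OF assms(1,2)] by (intro emeasure_mono) auto
  then have "emeasure (predict u \<mu>) (C \<inter> Ob j) = 0"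
    by (simp add: emeasure_predict_Ob[OF assms(1,2)] p0)
  then show ?thesis by (simp add: p0)
qed

lemma update_measurable:
  assumes adm: "admissible_family S classes Ob \<rho>"
    and \<kappa>: "\<kappa> \<in> info t \<rightarrow>\<^sub>M prob_algebra S"
  shows "(\<lambda>\<omega>. \<Phi> \<rho> (Y (Suc t) \<omega>) (\<kappa> \<omega>) (U t \<omega>)) \<in> info (Suc t) \<rightarrow>\<^sub>M prob_algebra S"
proof (rule measurable_compose_countable'[OF _ Y_measurable_info])
  show "countable classes" using finite_classes by (rule countable_finite)
  fix j assume j: "j \<in> classes"
  have sub: "subalgebra (info (Suc t)) (info t)"
    using sets_info_mono[of t "Suc t"] by (simp add: subalgebra_def)
  show "(\<lambda>\<omega>. \<Phi> \<rho> j (\<kappa> \<omega>) (U t \<omega>)) \<in> info (Suc t) \<rightarrow>\<^sub>M prob_algebra S"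
    using measurable_compose[OF measurable_Pair[OF \<kappa> U_adapted[of t]] measurable_\<Phi>[OF adm j]]
    by (intro measurable_from_subalg[OF sub]) simp
qed

text \<open>On the event \<open>Y (t + 1) = j\<close> the updated state is \<open>\<Phi>\<^sub>j\<close> applied to quantities known at time
  \<open>t\<close>.  Integrating it over that event therefore multiplies it by the predicted probability \<open>p\<^sub>j\<close>,
  which turns \<open>\<Phi>\<^sub>j\<close> into the prediction restricted to the class \<open>j\<close>; summing over the classes
  recovers the law of \<open>X (t + 1)\<close>.\<close>

lemma updated_cond_law:
  assumes adm: "admissible_family S classes Ob \<rho>"
    and law: "cond_law M (info t) S (X t) \<kappa>"
  shows "cond_law M (info (Suc t)) S (X (Suc t)) (\<lambda>\<omega>. \<Phi> \<rho> (Y (Suc t) \<omega>) (\<kappa> \<omega>) (U t \<omega>))"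
  unfolding cond_law_def
proof (intro conjI ballI)
  have \<kappa>: "\<kappa> \<in> info t \<rightarrow>\<^sub>M prob_algebra S" using law by (simp add: cond_law_def)
  show "(\<lambda>\<omega>. \<Phi> \<rho> (Y (Suc t) \<omega>) (\<kappa> \<omega>) (U t \<omega>)) \<in> info (Suc t) \<rightarrow>\<^sub>M prob_algebra S"
    by (rule update_measurable[OF adm \<kappa>])
  fix H C assume H: "H \<in> sets (info (Suc t))" and C [measurable]: "C \<in> sets S"
  obtain h where h: "\<And>j. h j \<in> sets (info t)" and Hh: "H = {\<omega>\<in>space M. \<omega> \<in> h (Y (Suc t) \<omega>)}"
    using info_Suc_decompose[OF H] by blast
  have hM: "h j \<in> sets M" for j using h[of j] subalgebra_info[of t] by (auto simp: subalgebra_def)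
  have sp: "U t \<omega> \<in> space Act" "\<kappa> \<omega> \<in> space (prob_algebra S)" if "\<omega> \<in> space M" for \<omega>
    using that measurable_space[OF U_adapted[of t]] measurable_space[OF \<kappa>] by auto
  note pred = predicted_cond_law[OF law]
  have step: "emeasure M (h j \<inter> X (Suc t) -` (C \<inter> Ob j)) =
      (\<integral>\<^sup>+\<omega>. indicator (h j) \<omega> * emeasure (\<Phi> \<rho> j (\<kappa> \<omega>) (U t \<omega>)) C * indicator (Ob j) (X (Suc t) \<omega>) \<partial>M)"
    if j: "j \<in> classes" for j
  proof -
    let ?a = "\<lambda>\<omega>. indicator (h j) \<omega> * emeasure (\<Phi> \<rho> j (\<kappa> \<omega>) (U t \<omega>)) C"
    have \<Phi>: "(\<lambda>\<omega>. \<Phi> \<rho> j (\<kappa> \<omega>) (U t \<omega>)) \<in> info t \<rightarrow>\<^sub>M prob_algebra S"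
      using measurable_compose[OF measurable_Pair[OF \<kappa> U_adapted[of t]] measurable_\<Phi>[OF adm j]] by simp
    have a [measurable]: "?a \<in> borel_measurable (info t)"
      using measurable_emeasure_kernel[OF measurable_prob_algebraD[OF \<Phi>] C] h
      by (intro borel_measurable_times_ennreal borel_measurable_indicator)
    have "(\<lambda>(\<omega>, x). ?a \<omega> * indicator (Ob j) x) \<in> borel_measurable (info t \<Otimes>\<^sub>M S)"
      using measurable_compose[OF measurable_fst a] by measurable
    note cond_law_nn_integral[OF prob_space_axioms subalgebra_info X_measurable pred this]
    then have "(\<integral>\<^sup>+\<omega>. ?a \<omega> * indicator (Ob j) (X (Suc t) \<omega>) \<partial>M) =
        (\<integral>\<^sup>+\<omega>. \<integral>\<^sup>+x. ?a \<omega> * indicator (Ob j) x \<partial>predict (U t \<omega>) (\<kappa> \<omega>) \<partial>M)"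
      by simp
    also have "\<dots> = (\<integral>\<^sup>+\<omega>. indicator (h j) \<omega> * emeasure (predict (U t \<omega>) (\<kappa> \<omega>)) (C \<inter> Ob j) \<partial>M)"
    proof (rule nn_integral_cong)
      fix \<omega> assume "\<omega> \<in> space M"
      note \<omega> = sp[OF this]
      have "(\<integral>\<^sup>+x. ?a \<omega> * indicator (Ob j) x \<partial>predict (U t \<omega>) (\<kappa> \<omega>)) = ?a \<omega> * ennreal (p j (\<kappa> \<omega>) (U t \<omega>))"
        unfolding emeasure_predict_Ob[OF \<omega>(2,1), symmetric]
        by (rule nn_integral_cmult_indicator) (simp add: predict_prob_space(2)[OF \<omega>(2,1)])
      then show "(\<integral>\<^sup>+x. ?a \<omega> * indicator (Ob j) x \<partial>predict (U t \<omega>) (\<kappa> \<omega>)) =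
          indicator (h j) \<omega> * emeasure (predict (U t \<omega>) (\<kappa> \<omega>)) (C \<inter> Ob j)"
        using \<Phi>_mass_times_p[OF \<omega>(2,1) C] by (simp add: mult.assoc)
    qed
    also have "\<dots> = emeasure M (h j \<inter> X (Suc t) -` (C \<inter> Ob j))"
      using pred h[of j] sets.Int[OF C sets_Ob[of j]] unfolding cond_law_def by metis
    finally show ?thesis by simp
  qed
  have decomp: "H \<inter> X (Suc t) -` C = (\<Union>j\<in>classes. h j \<inter> X (Suc t) -` (C \<inter> Ob j))"
  proof (intro set_eqI iffI)
    fix \<omega> assume "\<omega> \<in> H \<inter> X (Suc t) -` C"
    then show "\<omega> \<in> (\<Union>j\<in>classes. h j \<inter> X (Suc t) -` (C \<inter> Ob j))"
      using Y_in_classes[of \<omega> "Suc t"] X_in_class[of \<omega> "Suc t"] by (auto simp: Hh)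
  next
    fix \<omega> assume "\<omega> \<in> (\<Union>j\<in>classes. h j \<inter> X (Suc t) -` (C \<inter> Ob j))"
    then obtain j where j: "j \<in> classes" "\<omega> \<in> h j" "X (Suc t) \<omega> \<in> C" "X (Suc t) \<omega> \<in> Ob j" by blast
    moreover have "\<omega> \<in> space M" using sets.sets_into_space[OF hM] j by blast
    ultimately show "\<omega> \<in> H \<inter> X (Suc t) -` C" using Y_eq_iff[of \<omega> j "Suc t"] by (auto simp: Hh)
  qed
  have hX: "h j \<inter> X (Suc t) -` (C \<inter> Ob j) \<in> sets M" for j
  proof -
    have "h j \<inter> X (Suc t) -` (C \<inter> Ob j) = h j \<inter> (X (Suc t) -` (C \<inter> Ob j) \<inter> space M)"
      using sets.sets_into_space[OF hM] by blast
    then show ?thesis using hM measurable_sets[OF X_measurable] by simp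
  qed
  have "emeasure M (H \<inter> X (Suc t) -` C) = (\<Sum>j\<in>classes. emeasure M (h j \<inter> X (Suc t) -` (C \<inter> Ob j)))"
    unfolding decomp using finite_classes hX Ob_disjoint
    by (intro sum_emeasure[symmetric]) (auto simp: disjoint_family_on_def)
  also have "\<dots> = (\<Sum>j\<in>classes. \<integral>\<^sup>+\<omega>. indicator (h j) \<omega> * emeasure (\<Phi> \<rho> j (\<kappa> \<omega>) (U t \<omega>)) C
      * indicator (Ob j) (X (Suc t) \<omega>) \<partial>M)"
    by (rule sum.cong[OF refl step])
  also have "\<dots> = (\<integral>\<^sup>+\<omega>. (\<Sum>j\<in>classes. indicator (h j) \<omega> * emeasure (\<Phi> \<rho> j (\<kappa> \<omega>) (U t \<omega>)) C
      * indicator (Ob j) (X (Suc t) \<omega>)) \<partial>M)"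
  proof (rule nn_integral_sum[symmetric])
    fix j assume j: "j \<in> classes"
    have "(\<lambda>\<omega>. \<Phi> \<rho> j (\<kappa> \<omega>) (U t \<omega>)) \<in> info t \<rightarrow>\<^sub>M prob_algebra S"
      using measurable_compose[OF measurable_Pair[OF \<kappa> U_adapted[of t]] measurable_\<Phi>[OF adm j]] by simp
    then have "(\<lambda>\<omega>. \<Phi> \<rho> j (\<kappa> \<omega>) (U t \<omega>)) \<in> M \<rightarrow>\<^sub>M prob_algebra S"
      by (rule measurable_from_subalg[OF subalgebra_info])
    note measurable_emeasure_kernel[OF measurable_prob_algebraD[OF this] C, measurable]
    note hM [measurable]
    show "(\<lambda>\<omega>. indicator (h j) \<omega> * emeasure (\<Phi> \<rho> j (\<kappa> \<omega>) (U t \<omega>)) C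
      * indicator (Ob j) (X (Suc t) \<omega>)) \<in> borel_measurable M"
      by measurable
  qed
  also have "\<dots> = (\<integral>\<^sup>+\<omega>. indicator H \<omega> * emeasure (\<Phi> \<rho> (Y (Suc t) \<omega>) (\<kappa> \<omega>) (U t \<omega>)) C \<partial>M)"
  proof (rule nn_integral_cong)
    fix \<omega> assume \<omega>: "\<omega> \<in> space M"
    have "(\<Sum>j\<in>classes. indicator (h j) \<omega> * emeasure (\<Phi> \<rho> j (\<kappa> \<omega>) (U t \<omega>)) C * indicator (Ob j) (X (Suc t) \<omega>))
      = (\<Sum>j\<in>classes. if j = Y (Suc t) \<omega> then indicator (h j) \<omega> * emeasure (\<Phi> \<rho> j (\<kappa> \<omega>) (U t \<omega>)) C else 0)"
      using Y_eq_iff[OF \<omega>, of _ "Suc t"] by (intro sum.cong) (auto split: split_indicator)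
    also have "\<dots> = indicator (h (Y (Suc t) \<omega>)) \<omega> * emeasure (\<Phi> \<rho> (Y (Suc t) \<omega>) (\<kappa> \<omega>) (U t \<omega>)) C"
      using Y_in_classes[OF \<omega>] finite_classes by simp
    also have "\<dots> = indicator H \<omega> * emeasure (\<Phi> \<rho> (Y (Suc t) \<omega>) (\<kappa> \<omega>) (U t \<omega>)) C"
      using \<omega> by (simp add: Hh indicator_def)
    finally show "(\<Sum>j\<in>classes. indicator (h j) \<omega> * emeasure (\<Phi> \<rho> j (\<kappa> \<omega>) (U t \<omega>)) C * indicator (Ob j) (X (Suc t) \<omega>))
      = indicator H \<omega> * emeasure (\<Phi> \<rho> (Y (Suc t) \<omega>) (\<kappa> \<omega>) (U t \<omega>)) C" .
  qed
  finally show "emeasure M (H \<inter> X (Suc t) -` C) =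
    (\<integral>\<^sup>+\<omega>. indicator H \<omega> * emeasure (\<Phi> \<rho> (Y (Suc t) \<omega>) (\<kappa> \<omega>) (U t \<omega>)) C \<partial>M)" .
qed

lemma info_state_cond_law:
  assumes adm: "admissible_family S classes Ob \<rho>"
    and init: "regular_cond_law M (info 0) S (X 0) \<pi>\<^sub>0"
  shows "cond_law M (info t) S (X t) (info_state (\<Phi> \<rho>) \<pi>\<^sub>0 U Y t)"
proof (induction t)
  case 0
  have "info_state (\<Phi> \<rho>) \<pi>\<^sub>0 U Y 0 = \<pi>\<^sub>0" by (rule ext) simp
  then show ?case
    using regular_cond_law_imp_cond_law[OF prob_space_axioms subalgebra_info X_measurable init] by simp
next
  case (Suc t)
  have "info_state (\<Phi> \<rho>) \<pi>\<^sub>0 U Y (Suc t) =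
      (\<lambda>\<omega>. \<Phi> \<rho> (Y (Suc t) \<omega>) (info_state (\<Phi> \<rho>) \<pi>\<^sub>0 U Y t \<omega>) (U t \<omega>))"
    by (rule ext) simp
  then show ?case using updated_cond_law[OF adm Suc] by simp
qed

section \<open>Observations of predicted probability zero do not occur\<close>

text \<open>The event that \<open>p\<^sub>j\<close> vanishes is known at time \<open>t\<close>, and on it the class \<open>j\<close> has conditional
  probability zero; as there are finitely many classes, the exceptional events add up to a null
  set.\<close>

lemma AE_observed_prob_pos:
  assumes law: "cond_law M (info t) S (X t) \<kappa>"
  shows "AE \<omega> in M. p (Y (Suc t) \<omega>) (\<kappa> \<omega>) (U t \<omega>) > 0"
proof -
  have \<kappa>: "\<kappa> \<in> info t \<rightarrow>\<^sub>M prob_algebra S" using law by (simp add: cond_law_def)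
  have sp: "U t \<omega> \<in> space Act" "\<kappa> \<omega> \<in> space (prob_algebra S)" if "\<omega> \<in> space M" for \<omega>
    using that measurable_space[OF U_adapted[of t]] measurable_space[OF \<kappa>] by auto
  have each: "AE \<omega> in M. \<not> (p j (\<kappa> \<omega>) (U t \<omega>) = 0 \<and> X (Suc t) \<omega> \<in> Ob j)" for j
  proof -
    let ?H = "{\<omega> \<in> space M. p j (\<kappa> \<omega>) (U t \<omega>) = 0}"
    have "(\<lambda>\<omega>. p j (\<kappa> \<omega>) (U t \<omega>)) \<in> borel_measurable (info t)"
      using measurable_compose[OF measurable_Pair[OF \<kappa> U_adapted[of t]] p_measurable] by simp
    then have "{\<omega> \<in> space (info t). p j (\<kappa> \<omega>) (U t \<omega>) = 0} \<in> sets (info t)" by measurable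
    then have H: "?H \<in> sets (info t)" by simp
    then have HM: "?H \<in> sets M" using subalgebra_info[of t] by (auto simp: subalgebra_def)
    have "emeasure M (?H \<inter> X (Suc t) -` Ob j) =
        (\<integral>\<^sup>+\<omega>. indicator ?H \<omega> * emeasure (predict (U t \<omega>) (\<kappa> \<omega>)) (Ob j) \<partial>M)"
      using predicted_cond_law[OF law] H by (simp add: cond_law_def)
    also have "\<dots> = (\<integral>\<^sup>+\<omega>. 0 \<partial>M)"
      by (intro nn_integral_cong) (auto simp: emeasure_predict_Ob sp split: split_indicator)
    finally have null: "emeasure M (?H \<inter> X (Suc t) -` Ob j) = 0" by simp
    have "?H \<inter> X (Suc t) -` Ob j = ?H \<inter> (X (Suc t) -` Ob j \<inter> space M)" by blast
    then have "?H \<inter> X (Suc t) -` Ob j \<in> sets M" using HM measurable_sets[OF X_measurable] by simp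
    with null have "?H \<inter> X (Suc t) -` Ob j \<in> null_sets M" by blast
    then show ?thesis by (rule AE_I') auto
  qed
  have "AE \<omega> in M. \<forall>j\<in>classes. \<not> (p j (\<kappa> \<omega>) (U t \<omega>) = 0 \<and> X (Suc t) \<omega> \<in> Ob j)"
    using each finite_classes by (intro AE_finite_allI)
  then show ?thesis
  proof (rule AE_mp, intro AE_I2 impI)
    fix \<omega> assume \<omega>: "\<omega> \<in> space M"
      and "\<forall>j\<in>classes. \<not> (p j (\<kappa> \<omega>) (U t \<omega>) = 0 \<and> X (Suc t) \<omega> \<in> Ob j)"
    then have "p (Y (Suc t) \<omega>) (\<kappa> \<omega>) (U t \<omega>) \<noteq> 0"
      using Y_in_classes[OF \<omega>] X_in_class[OF \<omega>] by blast
    moreover have "p (Y (Suc t) \<omega>) (\<kappa> \<omega>) (U t \<omega>) \<ge> 0" by (simp add: obs_prob_def)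
    ultimately show "p (Y (Suc t) \<omega>) (\<kappa> \<omega>) (U t \<omega>) > 0" by simp
  qed
qed

text \<open>Two recursions that agree up to time \<open>t\<close> use the same branch of the update at time
  \<open>t + 1\<close>, and almost surely this is the branch that does not involve the fallback measures.\<close>

lemma AE_info_trajectory_eq:
  assumes adm: "admissible_family S classes Ob \<rho>"
    and init: "regular_cond_law M (info 0) S (X 0) \<pi>\<^sub>0"
  shows "AE \<omega> in M. info_trajectory (\<Phi> \<rho>) \<pi>\<^sub>0 U Y \<omega> = info_trajectory (\<Phi> \<rho>') \<pi>\<^sub>0 U Y \<omega>"
proof -
  let ?\<pi> = "info_state (\<Phi> \<rho>) \<pi>\<^sub>0 U Y" and ?\<pi>' = "info_state (\<Phi> \<rho>') \<pi>\<^sub>0 U Y"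
  have "AE \<omega> in M. \<forall>t. p (Y (Suc t) \<omega>) (?\<pi> t \<omega>) (U t \<omega>) > 0"
    using AE_observed_prob_pos[OF info_state_cond_law[OF adm init]] by (simp add: AE_all_countable)
  then show ?thesis
  proof (rule AE_mp, intro AE_I2 impI)
    fix \<omega> assume pos: "\<forall>t. p (Y (Suc t) \<omega>) (?\<pi> t \<omega>) (U t \<omega>) > 0"
    have "?\<pi> t \<omega> = ?\<pi>' t \<omega>" for t
    proof (induction t)
      case (Suc t)
      have "p (Y (Suc t) \<omega>) (?\<pi> t \<omega>) (U t \<omega>) > 0" using pos by blast
      then have "\<Phi> \<rho> (Y (Suc t) \<omega>) (?\<pi> t \<omega>) (U t \<omega>) = \<Phi> \<rho>' (Y (Suc t) \<omega>) (?\<pi> t \<omega>) (U t \<omega>)"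
        by (simp add: filter_map_def)
      with Suc show ?case by simp
    qed simp
    then show "info_trajectory (\<Phi> \<rho>) \<pi>\<^sub>0 U Y \<omega> = info_trajectory (\<Phi> \<rho>') \<pi>\<^sub>0 U Y \<omega>"
      by (simp add: info_trajectory_def fun_eq_iff)
  qed
qed

lemma info_trajectory_measurable:
  assumes adm: "admissible_family S classes Ob \<rho>"
    and init: "regular_cond_law M (info 0) S (X 0) \<pi>\<^sub>0"
  shows "info_trajectory (\<Phi> \<rho>) \<pi>\<^sub>0 U Y \<in> M \<rightarrow>\<^sub>M trajectory_space S classes"
proof -
  have coord: "(\<lambda>\<omega>. info_trajectory (\<Phi> \<rho>) \<pi>\<^sub>0 U Y \<omega> t) \<in> M \<rightarrow>\<^sub>M count_space classes \<Otimes>\<^sub>M prob_algebra S" for t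
  proof -
    have "info_state (\<Phi> \<rho>) \<pi>\<^sub>0 U Y t \<in> info t \<rightarrow>\<^sub>M prob_algebra S"
      using info_state_cond_law[OF adm init] by (simp add: cond_law_def)
    with Y_measurable_info[of t]
    have "(\<lambda>\<omega>. (Y t \<omega>, info_state (\<Phi> \<rho>) \<pi>\<^sub>0 U Y t \<omega>)) \<in> info t \<rightarrow>\<^sub>M count_space classes \<Otimes>\<^sub>M prob_algebra S"
      by (rule measurable_Pair)
    then show ?thesis
      unfolding info_trajectory_def by (rule measurable_from_subalg[OF subalgebra_info])
  qed
  show ?thesis
    unfolding trajectory_space_def
    by (rule measurable_PiM_single'[OF coord]) (use measurable_space[OF coord] in auto)
qed

end

theorem proposition5:
  fixes S :: "'x measure" and Act :: "'u measure" and E :: "'e measure" and V :: "'v measure"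
    and G :: "'x \<times> 'u \<times> 'e \<times> 'v \<Rightarrow> 'x"
    and \<nu>E :: "'e measure" and \<nu>V :: "'v measure"
    and m :: nat and A :: "nat \<Rightarrow> 'x set" and r :: nat and J :: "nat \<Rightarrow> nat set"
    and I :: "nat set" and Ob :: "nat \<Rightarrow> 'x set"
  assumes model: "observed_model S Act E V G \<nu>E \<nu>V m A r J"
    and Ob: "Ob = obs_class S A r J"
    and I: "I = obs_indices S A r J"
  shows
    "(\<forall>\<mu>\<in>space (prob_algebra S). \<forall>u\<in>space Act.
        predict_op S G \<nu>E \<nu>V u \<mu> \<in> space (prob_algebra S) \<and>
        (\<forall>C\<in>sets S. emeasure (predict_op S G \<nu>E \<nu>V u \<mu>) C
                      = (\<integral>\<^sup>+x. ctrl_kernel G \<nu>E \<nu>V C x u \<partial>\<mu>)))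
     \<and>
     (\<forall>\<mu>\<in>space (prob_algebra S). \<forall>u\<in>space Act. \<forall>j\<in>I.
        finite_measure (restricted_op S G \<nu>E \<nu>V Ob u j \<mu>) \<and>
        sets (restricted_op S G \<nu>E \<nu>V Ob u j \<mu>) = sets S \<and>
        (\<forall>C\<in>sets S. emeasure (restricted_op S G \<nu>E \<nu>V Ob u j \<mu>) C
                      = emeasure (predict_op S G \<nu>E \<nu>V u \<mu>) (C \<inter> Ob j)) \<and>
        emeasure (restricted_op S G \<nu>E \<nu>V Ob u j \<mu>) (space S - Ob j) = 0)
     \<and>
     (\<forall>j\<in>I. (\<lambda>(\<mu>, u). obs_prob S G \<nu>E \<nu>V Ob j \<mu> u)
              \<in> borel_measurable (prob_algebra S \<Otimes>\<^sub>M Act)) \<and>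
     (\<forall>\<mu>\<in>space (prob_algebra S). \<forall>u\<in>space Act.
        (\<Sum>j\<in>I. obs_prob S G \<nu>E \<nu>V Ob j \<mu> u) = 1)
     \<and>
     (\<forall>\<rho>. admissible_family S I Ob \<rho> \<longrightarrow>
        (\<forall>j\<in>I. (\<lambda>(\<mu>, u). filter_map S G \<nu>E \<nu>V Ob \<rho> j \<mu> u)
                 \<in> prob_algebra S \<Otimes>\<^sub>M Act \<rightarrow>\<^sub>M prob_algebra S \<and>
               (\<forall>\<mu>\<in>space (prob_algebra S). \<forall>u\<in>space Act.
                  emeasure (filter_map S G \<nu>E \<nu>V Ob \<rho> j \<mu> u) (Ob j) = 1)))
     \<and>
     (\<forall>(M :: 'w measure) X U \<eta> \<epsilon> Y \<pi>\<^sub>0 \<rho> \<rho>'.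
        controlled_process S Act E V G \<nu>E \<nu>V m A r J M X U \<eta> \<epsilon> Y \<longrightarrow>
        regular_cond_law M (info_algebra M Act Y U 0) S (X 0) \<pi>\<^sub>0 \<longrightarrow>
        admissible_family S I Ob \<rho> \<longrightarrow> admissible_family S I Ob \<rho>' \<longrightarrow>
        info_trajectory (filter_map S G \<nu>E \<nu>V Ob \<rho>) \<pi>\<^sub>0 U Y \<in> M \<rightarrow>\<^sub>M trajectory_space S I \<and>
        info_trajectory (filter_map S G \<nu>E \<nu>V Ob \<rho>') \<pi>\<^sub>0 U Y \<in> M \<rightarrow>\<^sub>M trajectory_space S I \<and>
        distr M (trajectory_space S I) (info_trajectory (filter_map S G \<nu>E \<nu>V Ob \<rho>) \<pi>\<^sub>0 U Y)
        = distr M (trajectory_space S I) (info_trajectory (filter_map S G \<nu>E \<nu>V Ob \<rho>') \<pi>\<^sub>0 U Y))"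
proof -
  interpret observed_model S Act E V G \<nu>E \<nu>V m A r J by (rule model)
  show ?thesis
  proof (intro conjI ballI allI impI)
    fix \<mu> u assume \<mu>u: "\<mu> \<in> space (prob_algebra S)" "u \<in> space Act"
    show "predict_op S G \<nu>E \<nu>V u \<mu> \<in> space (prob_algebra S)"
      by (rule predict_in_prob_algebra[OF \<mu>u])
    show "emeasure (predict_op S G \<nu>E \<nu>V u \<mu>) C = (\<integral>\<^sup>+x. ctrl_kernel G \<nu>E \<nu>V C x u \<partial>\<mu>)"
      if "C \<in> sets S" for C
      by (rule emeasure_predict[OF \<mu>u that])
    show "(\<Sum>j\<in>I. obs_prob S G \<nu>E \<nu>V Ob j \<mu> u) = 1"
      unfolding Ob I by (rule p_sum[OF \<mu>u])
    fix j
    show "finite_measure (restricted_op S G \<nu>E \<nu>V Ob u j \<mu>)"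
      unfolding Ob by (rule finite_measure_restricted[OF \<mu>u])
    show "sets (restricted_op S G \<nu>E \<nu>V Ob u j \<mu>) = sets S"
      unfolding Ob by (rule sets_restricted[OF \<mu>u])
    show "emeasure (restricted_op S G \<nu>E \<nu>V Ob u j \<mu>) C = emeasure (predict_op S G \<nu>E \<nu>V u \<mu>) (C \<inter> Ob j)"
      if "C \<in> sets S" for C
      unfolding Ob by (rule emeasure_restricted_op[OF \<mu>u that])
    have "(space S - obs_class S A r J j) \<inter> obs_class S A r J j = {}" by blast
    then show "emeasure (restricted_op S G \<nu>E \<nu>V Ob u j \<mu>) (space S - Ob j) = 0"
      unfolding Ob by (simp add: emeasure_restricted_op[OF \<mu>u])
  next
    fix j
    show "(\<lambda>(\<mu>, u). obs_prob S G \<nu>E \<nu>V Ob j \<mu> u) \<in> borel_measurable (prob_algebra S \<Otimes>\<^sub>M Act)"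
      unfolding Ob by (rule p_measurable)
  next
    fix \<rho> j assume "admissible_family S I Ob \<rho>" "j \<in> I"
    then have adm: "admissible_family S (obs_indices S A r J) (obs_class S A r J) \<rho>"
      and j: "j \<in> obs_indices S A r J" by (simp_all add: Ob I)
    show "(\<lambda>(\<mu>, u). filter_map S G \<nu>E \<nu>V Ob \<rho> j \<mu> u) \<in> prob_algebra S \<Otimes>\<^sub>M Act \<rightarrow>\<^sub>M prob_algebra S"
      unfolding Ob by (rule measurable_\<Phi>[OF adm j])
    show "emeasure (filter_map S G \<nu>E \<nu>V Ob \<rho> j \<mu> u) (Ob j) = 1"
      if "\<mu> \<in> space (prob_algebra S)" "u \<in> space Act" for \<mu> u
      unfolding Ob by (rule emeasure_\<Phi>_Ob[OF adm j that])
  next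
    fix M :: "'w measure" and X U \<eta> \<epsilon> Y \<pi>\<^sub>0 \<rho> \<rho>'
    assume process: "controlled_process S Act E V G \<nu>E \<nu>V m A r J M X U \<eta> \<epsilon> Y"
      and init: "regular_cond_law M (info_algebra M Act Y U 0) S (X 0) \<pi>\<^sub>0"
      and adm: "admissible_family S I Ob \<rho>" "admissible_family S I Ob \<rho>'"
    interpret controlled_process S Act E V G \<nu>E \<nu>V m A r J M X U \<eta> \<epsilon> Y by (rule process)
    note adm = adm[unfolded Ob I]
    show meas: "info_trajectory (filter_map S G \<nu>E \<nu>V Ob \<rho>) \<pi>\<^sub>0 U Y \<in> M \<rightarrow>\<^sub>M trajectory_space S I"
      "info_trajectory (filter_map S G \<nu>E \<nu>V Ob \<rho>') \<pi>\<^sub>0 U Y \<in> M \<rightarrow>\<^sub>M trajectory_space S I"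
      unfolding Ob I by (rule info_trajectory_measurable[OF adm(1) init] info_trajectory_measurable[OF adm(2) init])+
    show "distr M (trajectory_space S I) (info_trajectory (filter_map S G \<nu>E \<nu>V Ob \<rho>) \<pi>\<^sub>0 U Y)
        = distr M (trajectory_space S I) (info_trajectory (filter_map S G \<nu>E \<nu>V Ob \<rho>') \<pi>\<^sub>0 U Y)"
      using AE_info_trajectory_eq[OF adm(1) init] meas unfolding Ob
      by (intro distr_cong_AE) simp_all
  qed
qed

end
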